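(* Let $K$ be a framed knot and let $z,w\in\mathbb C$. The power series $\frac{J^z}{2z+1}(K)$ and $\frac{L^{z,w}}{(2z+1)(2w+1)}(K)$ in $\mathbb C[[h]]$ are of Gevrey type $1$; that is, their formal Borel transforms define analytic functions in a neighbourhood of zero.
   Context: A formal power series $\sum_{n\ge0}a_nh^n$ over $\mathbb C$ is of Gevrey type $1$ if there is a constant $C>0$ with $|a_n|\le C^n\,n!$ for all $n\in\mathbb N=\{1,2,\dots\}$. Its formal Borel transform is $a_0\delta(\xi)+\sum_{n\ge0}\frac{a_{n+1}}{n!}\xi^n$ (analyticity refers to the power series part). For $\alpha\in\{0,\frac12,1,\frac32,\dots\}$ let $J^\alpha(K)$ be the framed coloured Jones polynomial of a framed knot $K$ associated with the spin $\alpha$ (dimension $2\alpha+1$) representation of $U_h(\mathfrak{sl}(2,\mathbb C))$, with $q=e^h$, regarded as a power series in $h$ and normalised so that on the zero-framed unknot it equals the quantum dimension $\sinh((2\alpha+1)h/2)/\sinh(h/2)$. The $z$-coloured Jones polynomial: for each $K$ there are unique polynomials $J_n^z(K)$ in $z$ (of degree at most $2n$) such that $\frac{J^\alpha(K)}{2\alpha+1}=\sum_{n\ge0}J_n^\alpha(K)h^n$ for all $\alpha\in\frac12\mathbb Z_{\ge 0}$ (Melvin–Morton expansion). For any $z\in\mathbb C$ one sets $\frac{J^z}{2z+1}(K)=\sum_{n\ge0}J_n^z(K)h^n\in\mathbb C[[h]]$; the left hand side is a single symbol, also defined if $2z+1=0$. (Equivalently it is the evaluation, on the framed Kontsevich integral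 of $K$, of the $\mathfrak{sl}(2,\mathbb C)$ weight system composed with the central character of the highest weight representation of highest weight $2z$.) The Lorentz polynomial is $\frac{L^{z,w}}{(2z+1)(2w+1)}(K)=\frac{J^z}{2z+1}(K)\cdot\frac{J^w}{2w+1}(K^* )$, where $K^*$ is the mirror image of the framed knot $K$. *)

theory Defs
  imports "HOL-Analysis.Analysis" "Jordan_Normal_Form.Matrix"
begin

section \<open>Framed knots\<close>

text \<open>
  A framed knot is given by an oriented planar diagram with the blackboard framing. Diagrams are in
  Morse position: a diagram is a list of horizontal layers, read from bottom to top, and each layer
  consists of one elementary oriented tangle with vertical strands to its left and to its right.
  Every framed oriented link has such a diagram, because the elementary tangles below generate the
  category of framed oriented tangles (crossings of strands that are not both directed upwards are
  obtained by rotating with cups and caps, and every framing is obtained by inserting kinks).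
\<close>

datatype orient = Up | Down

text \<open>
  The two letters are the orientations of the two end points, from left to right; thus \<open>CapUD\<close> is
  the maximum traversed from left to right. \<open>Pos\<close> and \<open>Neg\<close> are the crossings of two upward strands,
  of sign +1 and -1.
\<close>

datatype elem = CapDU | CapUD | CupUD | CupDU | Pos | Neg

primrec elem_src :: "elem \<Rightarrow> orient list" where
  "elem_src CapDU = [Down, Up]"
| "elem_src CapUD = [Up, Down]"
| "elem_src CupUD = []"
| "elem_src CupDU = []"
| "elem_src Pos = [Up, Up]"
| "elem_src Neg = [Up, Up]"

primrec elem_tgt :: "elem \<Rightarrow> orient list" where
  "elem_tgt CapDU = []"
| "elem_tgt CapUD = []"
| "elem_tgt CupUD = [Up, Down]"
| "elem_tgt CupDU = [Down, Up]"
| "elem_tgt Pos = [Up, Up]"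
| "elem_tgt Neg = [Up, Up]"

type_synonym layer = "orient list \<times> elem \<times> orient list"

type_synonym diagram = "layer list"

fun layer_src :: "layer \<Rightarrow> orient list" where
  "layer_src (l, e, r) = l @ elem_src e @ r"

fun layer_tgt :: "layer \<Rightarrow> orient list" where
  "layer_tgt (l, e, r) = l @ elem_tgt e @ r"

fun composable :: "orient list \<Rightarrow> diagram \<Rightarrow> orient list \<Rightarrow> bool" where
  "composable u [] v \<longleftrightarrow> u = v"
| "composable u (L # D) v \<longleftrightarrow> u = layer_src L \<and> composable (layer_tgt L) D v"

text \<open>
  The point \<open>(k, i)\<close> is the \<open>i\<close>-th strand end on the horizontal line below layer \<open>k\<close>. The arcs of
  layer \<open>k\<close> join points on the lines below and above it.
\<close>

definition points :: "diagram \<Rightarrow> (nat \<times> nat) set" where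
  "points D = {(k, i). k < length D \<and> i < length (layer_src (D ! k))}"

fun elem_arcs :: "nat \<Rightarrow> nat \<Rightarrow> elem \<Rightarrow> ((nat \<times> nat) \<times> (nat \<times> nat)) set" where
  "elem_arcs k i CapDU = {((k, i), (k, i + 1))}"
| "elem_arcs k i CapUD = {((k, i), (k, i + 1))}"
| "elem_arcs k i CupUD = {((k + 1, i), (k + 1, i + 1))}"
| "elem_arcs k i CupDU = {((k + 1, i), (k + 1, i + 1))}"
| "elem_arcs k i Pos = {((k, i), (k + 1, i + 1)), ((k, i + 1), (k + 1, i))}"
| "elem_arcs k i Neg = {((k, i), (k + 1, i + 1)), ((k, i + 1), (k + 1, i))}"

fun layer_arcs :: "nat \<Rightarrow> layer \<Rightarrow> ((nat \<times> nat) \<times> (nat \<times> nat)) set" where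
  "layer_arcs k (l, e, r) =
     {((k, i), (k + 1, i)) | i. i < length l} \<union>
     elem_arcs k (length l) e \<union>
     {((k, length l + length (elem_src e) + j), (k + 1, length l + length (elem_tgt e) + j))
        | j. j < length r}"

definition arcs :: "diagram \<Rightarrow> ((nat \<times> nat) \<times> (nat \<times> nat)) set" where
  "arcs D = (\<Union>k<length D. layer_arcs k (D ! k))"

text \<open>A knot is a closed diagram, not empty, with exactly one component.\<close>

definition framed_knot :: "diagram \<Rightarrow> bool" where
  "framed_knot D \<longleftrightarrow> D \<noteq> [] \<and> composable [] D [] \<and>
     (\<forall>p\<in>points D. \<forall>q\<in>points D. (p, q) \<in> (arcs D \<union> (arcs D)\<inverse>)\<^sup>*)"

text \<open>
  The mirror image in the plane of the diagram; it also changes the sign of the framing.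
\<close>

primrec mirror_elem :: "elem \<Rightarrow> elem" where
  "mirror_elem CapDU = CapDU"
| "mirror_elem CapUD = CapUD"
| "mirror_elem CupUD = CupUD"
| "mirror_elem CupDU = CupDU"
| "mirror_elem Pos = Neg"
| "mirror_elem Neg = Pos"

definition mirror :: "diagram \<Rightarrow> diagram" where
  "mirror D = map (\<lambda>(l, e, r). (l, mirror_elem e, r)) D"


section \<open>The framed coloured Jones polynomial\<close>

text \<open>
  \<open>U\<^sub>h(sl(2,C))\<close> is generated over \<open>C[[h]]\<close> by \<open>H, E, F\<close> with \<open>[H,E] = 2E\<close>, \<open>[H,F] = -2F\<close> and
  \<open>[E,F] = sinh(hH/2) / sinh(h/2)\<close>. With \<open>K = exp(hH/2)\<close> the coproduct is
  \<open>\<Delta>(E) = E \<otimes> K + 1 \<otimes> E\<close>, \<open>\<Delta>(F) = F \<otimes> 1 + K\<^sup>-\<^sup>1 \<otimes> F\<close>, \<open>\<Delta>(H) = H \<otimes> 1 + 1 \<otimes> H\<close>, and the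
  universal R-matrix, for \<open>q = exp h\<close>, is
  \<open>R = q^(H\<otimes>H/4) (\<Sum>k. q^(k(k-1)/4) (q^(1/2) - q^(-1/2))^k / [k]! E^k \<otimes> F^k)\<close>.

  Formal power series in \<open>h\<close> have type \<open>complex fps\<close>, and \<open>q^c = exp(c h)\<close> is \<open>fps_exp c\<close>. The spin is
  \<open>\<alpha> = N / 2\<close> throughout, for a natural number \<open>N\<close>. The representation has the basis \<open>e_0, ..., e_N\<close>
  with \<open>H e_j = (N - 2 j) e_j\<close>, \<open>E e_j = [N - j + 1] e_(j-1)\<close>, \<open>F e_j = [j + 1] e_(j+1)\<close>.
\<close>

definition qint :: "nat \<Rightarrow> complex fps" where
  "qint n = (fps_exp (of_nat n / 2) - fps_exp (- of_nat n / 2)) / (fps_exp (1/2) - fps_exp (- 1/2))"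

definition qfact :: "nat \<Rightarrow> complex fps" where
  "qfact n = (\<Prod>j=1..n. qint j)"

definition weight :: "nat \<Rightarrow> nat \<Rightarrow> complex" where
  "weight N j = of_nat N - 2 * of_nat j"

definition rep_E :: "nat \<Rightarrow> complex fps mat" where
  "rep_E N = mat (N + 1) (N + 1) (\<lambda>(i, j). if j = i + 1 then qint (N - j + 1) else 0)"

definition rep_F :: "nat \<Rightarrow> complex fps mat" where
  "rep_F N = mat (N + 1) (N + 1) (\<lambda>(i, j). if i = j + 1 then qint (j + 1) else 0)"

text \<open>
  \<open>R_entry N i j a b\<close> is the coefficient of \<open>e_i \<otimes> e_j\<close> in \<open>R (e_a \<otimes> e_b)\<close>, and \<open>Rinv_entry\<close> is the same
  for the inverse of \<open>R\<close>. The sums stop at \<open>N\<close> because the \<open>(N + 1)\<close>-st powers of \<open>E\<close> and \<open>F\<close> are zero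
  in the representation.
\<close>

definition R_entry :: "nat \<Rightarrow> nat \<Rightarrow> nat \<Rightarrow> nat \<Rightarrow> nat \<Rightarrow> complex fps" where
  "R_entry N i j a b = fps_exp (weight N i * weight N j / 4) *
     (\<Sum>k\<le>N. fps_exp (of_nat k * (of_nat k - 1) / 4) * (fps_exp (1/2) - fps_exp (- 1/2)) ^ k / qfact k
        * (rep_E N ^\<^sub>m k) $$ (i, a) * (rep_F N ^\<^sub>m k) $$ (j, b))"

definition Rinv_entry :: "nat \<Rightarrow> nat \<Rightarrow> nat \<Rightarrow> nat \<Rightarrow> nat \<Rightarrow> complex fps" where
  "Rinv_entry N i j a b =
     (\<Sum>k\<le>N. (- 1) ^ k * fps_exp (- of_nat k * (of_nat k - 1) / 4)
        * (fps_exp (1/2) - fps_exp (- 1/2)) ^ k / qfact k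
        * (rep_E N ^\<^sub>m k) $$ (i, a) * (rep_F N ^\<^sub>m k) $$ (j, b))
     * fps_exp (- weight N a * weight N b / 4)"

text \<open>
  The Reshetikhin-Turaev functor. An upward strand is coloured by the representation \<open>V\<close>, a downward
  strand by its dual with the dual basis, and basis vectors of tensor products are lists of indices.
  \<open>elem_op N e t s\<close> is the coefficient of the basis vector \<open>t\<close> in the image of \<open>s\<close>. The pivotal
  element is \<open>K\<close>: the maps for \<open>CapUD\<close> and \<open>CupDU\<close> are \<open>x \<otimes> f \<mapsto> f (K x)\<close> and
  \<open>1 \<mapsto> (\<Sum>a. e^a \<otimes> K\<^sup>-\<^sup>1 e_a)\<close>. With \<open>\<tau>\<close> the flip, the crossings are \<open>\<tau> R\<close> and its inverse \<open>R\<^sup>-\<^sup>1 \<tau>\<close>.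
\<close>

primrec elem_op :: "nat \<Rightarrow> elem \<Rightarrow> nat list \<Rightarrow> nat list \<Rightarrow> complex fps" where
  "elem_op N CapDU t s = (if s ! 0 = s ! 1 then 1 else 0)"
| "elem_op N CapUD t s = (if s ! 0 = s ! 1 then fps_exp (weight N (s ! 0) / 2) else 0)"
| "elem_op N CupUD t s = (if t ! 0 = t ! 1 then 1 else 0)"
| "elem_op N CupDU t s = (if t ! 0 = t ! 1 then fps_exp (- weight N (t ! 0) / 2) else 0)"
| "elem_op N Pos t s = R_entry N (t ! 1) (t ! 0) (s ! 0) (s ! 1)"
| "elem_op N Neg t s = Rinv_entry N (t ! 0) (t ! 1) (s ! 1) (s ! 0)"

fun layer_op :: "nat \<Rightarrow> layer \<Rightarrow> nat list \<Rightarrow> nat list \<Rightarrow> complex fps" where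
  "layer_op N (l, e, r) t s =
     (let a = length l; m = length (elem_src e); n = length (elem_tgt e) in
      if take a t = take a s \<and> drop (a + n) t = drop (a + m) s
      then elem_op N e (take n (drop a t)) (take m (drop a s)) else 0)"

definition basis :: "nat \<Rightarrow> nat \<Rightarrow> nat list set" where
  "basis N n = {s. length s = n \<and> set s \<subseteq> {0..N}}"

fun diagram_op :: "nat \<Rightarrow> diagram \<Rightarrow> nat list \<Rightarrow> nat list \<Rightarrow> complex fps" where
  "diagram_op N [] t s = (if t = s then 1 else 0)"
| "diagram_op N (L # D) t s =
     (\<Sum>u\<in>basis N (length (layer_tgt L)). diagram_op N D t u * layer_op N L u s)"

definition jones :: "nat \<Rightarrow> diagram \<Rightarrow> complex fps" where
  "jones N D = diagram_op N D [] []"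

text \<open>The normalisation: the zero-framed unknot has value \<open>sinh((2\<alpha>+1)h/2) / sinh(h/2)\<close>.\<close>

definition unknot :: diagram where
  "unknot = [([], CupUD, []), ([], CapUD, [])]"

lemma framed_knot_unknot: "framed_knot unknot"
proof -
  have pts: "points unknot \<subseteq> {(1, 0), (1, 1)}"
    by (auto simp: points_def unknot_def less_Suc_eq nth_Cons split: nat.splits)
  have arc: "((1, 0), (1, 1)) \<in> arcs unknot"
    by (auto simp: arcs_def unknot_def intro!: bexI[of _ 0])
  have "(p, q) \<in> (arcs unknot \<union> (arcs unknot)\<inverse>)\<^sup>*"
    if "p \<in> points unknot" "q \<in> points unknot" for p q
  proof -
    have "p \<in> {(1, 0), (1, 1)}" "q \<in> {(1, 0), (1, 1)}"
      using pts that by auto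
    then show ?thesis
      using arc by auto
  qed
  then show ?thesis
    by (auto simp: framed_knot_def unknot_def)
qed

lemma jones_unknot: "jones N unknot = qint (N + 1)"
proof -
  define d where "d = fps_exp (1/2) - fps_exp (- 1/2 :: complex)"
  have d_nz: "d \<noteq> 0"
  proof
    assume "d = 0"
    then have "fps_nth d 1 = 0" by simp
    then show False by (simp add: d_def)
  qed
  have basis0: "basis N 0 = {[]}"
    by (auto simp: basis_def)
  have basis2: "basis N 2 = (\<lambda>(a, b). [a, b]) ` ({0..N} \<times> {0..N})"
    by (auto simp: basis_def length_Suc_conv numeral_2_eq_2 image_iff)
  have inj: "inj_on (\<lambda>(a::nat, b). [a, b]) ({0..N} \<times> {0..N})"
    by (auto simp: inj_on_def)
  have "jones N unknot =
      (\<Sum>(a, b)\<in>{0..N} \<times> {0..N}. if a = b then fps_exp (weight N a / 2) else 0)"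
    by (auto simp: jones_def unknot_def Let_def basis0 basis2[unfolded numeral_2_eq_2]
        sum.reindex[OF inj] intro!: sum.cong)
  also have "\<dots> = (\<Sum>a\<in>{0..N}. \<Sum>b\<in>{0..N}. if a = b then fps_exp (weight N a / 2) else 0)"
    by (rule sum.cartesian_product[symmetric])
  also have "\<dots> = (\<Sum>a\<in>{0..N}. fps_exp (weight N a / 2))"
    by (rule sum.cong) simp_all
  finally have J: "jones N unknot = (\<Sum>a\<le>N. fps_exp (weight N a / 2))"
    by (simp add: atLeast0AtMost)
  have step: "d * fps_exp (weight N a / 2) =
      fps_exp (of_nat (N + 1) / 2 - of_nat a) - fps_exp (of_nat (N + 1) / 2 - of_nat (Suc a))"
    for a
    by (simp add: d_def weight_def algebra_simps add_divide_distrib diff_divide_distrib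
        flip: fps_exp_add_mult)
  have "d * jones N unknot =
      (\<Sum>a\<le>N. fps_exp (of_nat (N + 1) / 2 - of_nat a) - fps_exp (of_nat (N + 1) / 2 - of_nat (Suc a)))"
    unfolding J sum_distrib_left step ..
  also have "\<dots> = fps_exp (of_nat (N + 1) / 2) - fps_exp (of_nat (N + 1) / 2 - of_nat (Suc N))"
    by (subst sum_telescope) simp
  also have "of_nat (N + 1) / 2 - of_nat (Suc N) = (- of_nat (N + 1) / 2 :: complex)"
    by (simp add: field_simps)
  finally have "jones N unknot * d = fps_exp (of_nat (N + 1) / 2) - fps_exp (- of_nat (N + 1) / 2)"
    by (simp add: mult.commute)
  then show ?thesis
    using d_nz unfolding qint_def d_def[symmetric] by (metis nonzero_mult_div_cancel_right)
qed


section \<open>The coloured Jones polynomial of complex spin\<close>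

text \<open>
  The polynomials in \<open>z\<close> of the Melvin-Morton expansion, indexed by the power of \<open>h\<close>. The dimension
  \<open>2\<alpha>+1\<close> is \<open>N + 1\<close>.
\<close>

definition jones_poly :: "diagram \<Rightarrow> nat \<Rightarrow> complex poly" where
  "jones_poly D n = (THE p. degree p \<le> 2 * n \<and>
     (\<forall>N::nat. poly p (of_nat N / 2) = fps_nth (jones N D) n / of_nat (N + 1)))"

text \<open>The single symbol \<open>J^z/(2z+1)\<close>.\<close>

definition zjones :: "diagram \<Rightarrow> complex \<Rightarrow> complex fps" where
  "zjones D z = Abs_fps (\<lambda>n. poly (jones_poly D n) z)"

text \<open>The single symbol \<open>L^(z,w)/((2z+1)(2w+1))\<close>.\<close>

definition lorentz :: "diagram \<Rightarrow> complex \<Rightarrow> complex \<Rightarrow> complex fps" where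
  "lorentz D z w = zjones D z * zjones (mirror D) w"


section \<open>Gevrey type and the formal Borel transform\<close>

definition gevrey1 :: "complex fps \<Rightarrow> bool" where
  "gevrey1 f \<longleftrightarrow> (\<exists>C>0. \<forall>n\<ge>1. norm (fps_nth f n) \<le> C ^ n * fact n)"

text \<open>The first component is the coefficient of the Dirac delta, the second the power series part.\<close>

definition borel_transform :: "complex fps \<Rightarrow> complex \<times> complex fps" where
  "borel_transform f = (fps_nth f 0, Abs_fps (\<lambda>n. fps_nth f (n + 1) / fact n))"

definition analytic_near_0 :: "complex fps \<Rightarrow> bool" where
  "analytic_near_0 g \<longleftrightarrow> (\<exists>r>0. \<exists>G. G analytic_on ball 0 r \<and>
     (\<forall>x\<in>ball 0 r. (\<lambda>n. fps_nth g n * x ^ n) sums G x))"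

end

theory Submission
  imports Defs
begin

text \<open>
  The proof works with the state sum that defines the coloured Jones polynomial. It does not use
  isotopy invariance or the action of the quantum group.

  \<^emph>\<open>Polynomiality.\<close> Write the coefficient of \<open>h^n\<close> as a sum over states, that is, over labellings of
  the points of the diagram by integers in \<open>[0, N]\<close>. At a crossing with parameter \<open>k\<close> one label drops
  by \<open>k\<close> and the other one rises by \<open>k\<close>, and the weight is divisible by \<open>h^k\<close>. Hence only
  \<open>k \<le> n\<close> matters and, as a knot is connected, all labels lie within a distance from the label \<open>a\<close>
  of a base point that does not depend on \<open>N\<close>: a state is \<open>a\<close> plus one of finitely many
  integer labellings. For each of these the weight is a polynomial in \<open>N\<close> and \<open>a\<close>, of total degree at
  most \<open>2 n\<close> at \<open>h^n\<close>. The condition that the labels stay in \<open>[0, N]\<close> can be dropped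
  (\<open>label_points\<close>): along the orientation, a quantum integer \<open>[0]\<close> prevents a label from coming back once it
  has left \<open>[0, N]\<close>, and a knot is a closed curve. Finally, the sum over \<open>0 \<le> a \<le> N\<close> of a polynomial
  of degree \<open>d\<close> in \<open>N\<close> and \<open>a\<close> is \<open>N + 1\<close> times a polynomial of degree at most \<open>d\<close> in \<open>N\<close>
  (\<open>sum_biv_poly\<close>). This proves the Melvin-Morton expansion, \<open>melvin_morton_expansion\<close>.

  \<^emph>\<open>Growth.\<close> For \<open>N \<le> 2 n\<close> each entry of an elementary operator, truncated at \<open>h^n\<close>, has weighted
  l1-norm at most \<open>A^n\<close> for the radius \<open>1 / (4 n)\<close>, with a constant \<open>A\<close>, and there are at most
  \<open>(2 n + 1)^W\<close> states, with \<open>W\<close> the number of points of the diagram. So the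
  coefficient of \<open>h^n\<close> is at most \<open>C^n n^n\<close>, which is of the order \<open>C^n n!\<close> (\<open>jones_nth_bound\<close>).
  A polynomial of degree at most \<open>2 n\<close> is determined by its values at \<open>N = 0, ..., 2 n\<close>, and Newton
  interpolation carries the bound over to any complex spin at the cost of another factor \<open>C^n\<close>
  (\<open>poly_norm_interpolation\<close>). The statement about the Lorentz polynomial follows because series of
  Gevrey type 1 are closed under products.
\<close>

section \<open>Polynomials in two variables and their sums\<close>

text \<open>
  \<open>biv_poly d f\<close>: the function \<open>f\<close> of two natural numbers is given by a complex polynomial in two
  variables of total degree at most \<open>d\<close>.
\<close>

inductive biv_poly :: "nat \<Rightarrow> (nat \<Rightarrow> nat \<Rightarrow> complex) \<Rightarrow> bool" where
  const: "biv_poly d (\<lambda>N a. c)"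
| add: "biv_poly d f \<Longrightarrow> biv_poly d g \<Longrightarrow> biv_poly d (\<lambda>N a. f N a + g N a)"
| mult_fst: "biv_poly d f \<Longrightarrow> biv_poly (Suc d) (\<lambda>N a. of_nat N * f N a)"
| mult_snd: "biv_poly d f \<Longrightarrow> biv_poly (Suc d) (\<lambda>N a. of_nat a * f N a)"

lemma biv_poly_mono:
  assumes "biv_poly d f" "d \<le> e"
  shows "biv_poly e f"
  using assms
proof (induction arbitrary: e)
  case (mult_fst d f)
  then obtain e' where "e = Suc e'" "d \<le> e'" by (cases e) auto
  then show ?case using mult_fst biv_poly.mult_fst by blast
next
  case (mult_snd d f)
  then obtain e' where "e = Suc e'" "d \<le> e'" by (cases e) auto
  then show ?case using mult_snd biv_poly.mult_snd by blast
qed (auto intro: biv_poly.intros)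

lemma biv_poly_cmult:
  assumes "biv_poly d f"
  shows "biv_poly d (\<lambda>N a. c * f N a)"
  using assms
proof induction
  case (add d f g)
  then show ?case using biv_poly.add[OF add.IH] by (simp add: algebra_simps)
next
  case (mult_fst d f)
  then show ?case using biv_poly.mult_fst[OF mult_fst.IH] by (simp add: algebra_simps)
next
  case (mult_snd d f)
  then show ?case using biv_poly.mult_snd[OF mult_snd.IH] by (simp add: algebra_simps)
qed (auto intro: biv_poly.intros)

lemma biv_poly_mult:
  assumes "biv_poly d f" "biv_poly e g"
  shows "biv_poly (d + e) (\<lambda>N a. f N a * g N a)"
  using assms
proof induction
  case (const d c)
  then show ?case using biv_poly_mono[OF biv_poly_cmult] by simp
next
  case (add d f f')
  then show ?case using biv_poly.add[OF add.IH] by (simp add: algebra_simps)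
next
  case (mult_fst d f)
  then show ?case using biv_poly.mult_fst[OF mult_fst.IH] by (simp add: algebra_simps)
next
  case (mult_snd d f)
  then show ?case using biv_poly.mult_snd[OF mult_snd.IH] by (simp add: algebra_simps)
qed

lemma biv_poly_power:
  assumes "biv_poly d f"
  shows "biv_poly (n * d) (\<lambda>N a. f N a ^ n)"
proof (induction n)
  case 0
  then show ?case by (auto intro: biv_poly.intros)
next
  case (Suc n)
  then show ?case using biv_poly_mult[OF assms Suc] by simp
qed

lemma biv_poly_sum:
  assumes "\<And>i. i \<in> I \<Longrightarrow> biv_poly d (f i)"
  shows "biv_poly d (\<lambda>N a. \<Sum>i\<in>I. f i N a)"
  using assms by (induction I rule: infinite_finite_induct) (auto intro: biv_poly.intros)

lemma biv_poly_fst: "biv_poly 1 (\<lambda>N a. of_nat N)"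
  using mult_fst[OF const[of 0 1]] by simp

lemma biv_poly_snd: "biv_poly 1 (\<lambda>N a. of_nat a)"
  using mult_snd[OF const[of 0 1]] by simp

lemma biv_poly_linear: "biv_poly 1 (\<lambda>N a. c * of_nat N + c' * of_nat a + c'')"
  by (intro biv_poly.add biv_poly_cmult biv_poly_fst biv_poly_snd biv_poly.const)

lemma gbinomial_Suc_mult:
  "of_nat (Suc k) * (x gchoose Suc k) = (x - of_nat k) * (x gchoose k :: complex)"
  using gbinomial_mult_1[of x k] by (simp add: algebra_simps)

lemma binomial_polynomial:
  "\<exists>p::complex poly. degree p \<le> j \<and> (\<forall>x. poly p x = x gchoose j)"
proof (induction j)
  case 0
  show ?case by (intro exI[of _ 1]) simp
next
  case (Suc j)
  then obtain p :: "complex poly" where p: "degree p \<le> j" "\<And>x. poly p x = x gchoose j" by blast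
  define q where "q = Polynomial.smult (1 / of_nat (Suc j)) ([:- of_nat j, 1:] * p)"
  have "degree q \<le> Suc j"
    using p(1) degree_mult_le[of "[:- of_nat j, 1:]" p] by (simp add: q_def)
  moreover have "poly q x = x gchoose Suc j" for x
    using gbinomial_Suc_mult[of j x] by (simp add: q_def p(2) field_simps del: of_nat_Suc)
  ultimately show ?case by blast
qed

text \<open>
  The hockey-stick identity gives \<open>\<Sum>a\<le>N. binom(a, j) = (N + 1) / (j + 1) binom(N, j)\<close>. The binomial
  coefficient is carried through the induction to absorb factors \<open>a\<close>.
\<close>

lemma sum_binomial_biv_poly:
  assumes "biv_poly d f"
  shows "\<exists>p. degree p \<le> d + j \<and>
    (\<forall>N. (\<Sum>a\<le>N. of_nat (a choose j) * f N a) = of_nat (N + 1) * poly p (of_nat N))"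
  using assms
proof (induction arbitrary: j)
  case (const d c)
  obtain p :: "complex poly" where p: "degree p \<le> j" "\<And>x. poly p x = x gchoose j"
    using binomial_polynomial by blast
  have "(\<Sum>a\<le>N. of_nat (a choose j) * c) = of_nat (N + 1) * poly (Polynomial.smult (c / of_nat (j + 1)) p) (of_nat N)" for N
  proof -
    have "(\<Sum>a\<le>N. a choose j) * Suc j = Suc N * (N choose j)"
      by (simp only: sum_choose_upper Suc_times_binomial_eq)
    then have "of_nat ((\<Sum>a\<le>N. a choose j) * Suc j) = (of_nat (Suc N * (N choose j)) :: complex)"
      by (rule arg_cong)
    then have "(\<Sum>a\<le>N. of_nat (a choose j)) * of_nat (Suc j) = (of_nat (Suc N) * of_nat (N choose j) :: complex)"
      by (simp only: of_nat_mult of_nat_sum)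
    then have "(\<Sum>a\<le>N. of_nat (a choose j)) = (of_nat (Suc N) * of_nat (N choose j) / of_nat (Suc j) :: complex)"
      by (metis nonzero_mult_div_cancel_right of_nat_Suc of_nat_neq_0)
    then show ?thesis
      by (simp add: p(2) binomial_gbinomial sum_distrib_right[symmetric] del: of_nat_Suc)
  qed
  moreover have "degree (Polynomial.smult (c / of_nat (j + 1)) p) \<le> d + j"
    using p(1) degree_smult_le[of "c / of_nat (j + 1)" p] by linarith
  ultimately show ?case by blast
next
  case (add d f g)
  obtain p where p: "degree p \<le> d + j"
    "\<And>N. (\<Sum>a\<le>N. of_nat (a choose j) * f N a) = of_nat (N + 1) * poly p (of_nat N)"
    using add.IH(1)[of j] by blast
  obtain q where q: "degree q \<le> d + j"
    "\<And>N. (\<Sum>a\<le>N. of_nat (a choose j) * g N a) = of_nat (N + 1) * poly q (of_nat N)"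
    using add.IH(2)[of j] by blast
  have "(\<Sum>a\<le>N. of_nat (a choose j) * (f N a + g N a)) = of_nat (N + 1) * poly (p + q) (of_nat N)" for N
    by (simp only: distrib_left sum.distrib p(2) q(2) poly_add)
  then show ?case
    using degree_add_le[OF p(1) q(1)] by blast
next
  case (mult_fst d f)
  obtain p where p: "degree p \<le> d + j"
    "\<And>N. (\<Sum>a\<le>N. of_nat (a choose j) * f N a) = of_nat (N + 1) * poly p (of_nat N)"
    using mult_fst.IH[of j] by blast
  have "(\<Sum>a\<le>N. of_nat (a choose j) * (of_nat N * f N a)) = of_nat (N + 1) * poly (pCons 0 p) (of_nat N)" for N
  proof -
    have "(\<Sum>a\<le>N. of_nat (a choose j) * (of_nat N * f N a)) = of_nat N * (\<Sum>a\<le>N. of_nat (a choose j) * f N a)"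
      by (simp add: sum_distrib_left mult.left_commute)
    then show ?thesis by (simp add: p(2) mult.left_commute del: of_nat_add)
  qed
  moreover have "degree (pCons 0 p) \<le> Suc d + j"
    using p(1) degree_pCons_le[of 0 p] by linarith
  ultimately show ?case by blast
next
  case (mult_snd d f)
  obtain p where p: "degree p \<le> d + j"
    "\<And>N. (\<Sum>a\<le>N. of_nat (a choose j) * f N a) = of_nat (N + 1) * poly p (of_nat N)"
    using mult_snd.IH[of j] by blast
  obtain q where q: "degree q \<le> d + Suc j"
    "\<And>N. (\<Sum>a\<le>N. of_nat (a choose Suc j) * f N a) = of_nat (N + 1) * poly q (of_nat N)"
    using mult_snd.IH[of "Suc j"] by blast
  define r where "r = Polynomial.smult (of_nat (Suc j)) q + Polynomial.smult (of_nat j) p"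
  have step: "of_nat (a choose j) * of_nat a =
      of_nat (Suc j) * of_nat (a choose Suc j) + (of_nat j * of_nat (a choose j) :: complex)" for a
    using gbinomial_mult_1[of "of_nat a :: complex" j] by (simp add: binomial_gbinomial algebra_simps)
  have "(\<Sum>a\<le>N. of_nat (a choose j) * (of_nat a * f N a)) = of_nat (N + 1) * poly r (of_nat N)" for N
  proof -
    have "(\<Sum>a\<le>N. of_nat (a choose j) * (of_nat a * f N a)) =
        (\<Sum>a\<le>N. (of_nat (a choose j) * of_nat a) * f N a)"
      by (simp add: mult.assoc)
    also have "\<dots> = of_nat (Suc j) * (\<Sum>a\<le>N. of_nat (a choose Suc j) * f N a)
        + of_nat j * (\<Sum>a\<le>N. of_nat (a choose j) * f N a)"
      unfolding step sum_distrib_left sum.distrib[symmetric]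
      by (simp only: distrib_right mult.assoc)
    also have "\<dots> = of_nat (N + 1) * poly r (of_nat N)"
      unfolding p(2) q(2) r_def by (simp only: poly_add poly_smult) (simp only: algebra_simps)
    finally show ?thesis .
  qed
  moreover have "degree r \<le> Suc d + j"
    using p(1) q(1) unfolding r_def
    by (intro degree_add_le) (auto intro: order_trans[OF degree_smult_le])
  ultimately show ?case by blast
qed

lemma sum_biv_poly:
  assumes "biv_poly d f"
  obtains p where "degree p \<le> d"
    "\<And>N. (\<Sum>a\<le>N. f N a) = of_nat (N + 1) * poly p (of_nat N)"
  using sum_binomial_biv_poly[OF assms, of 0] by auto

section \<open>Power series graded by degree\<close>

text \<open>
  \<open>graded e F\<close>: the coefficient of \<open>h^n\<close> in \<open>F N a\<close> is a polynomial in \<open>N\<close> and \<open>a\<close> of total degree at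
  most \<open>2 n + e\<close>. The Melvin-Morton bound on the degree is the case \<open>e = 0\<close>.
\<close>

definition graded :: "nat \<Rightarrow> (nat \<Rightarrow> nat \<Rightarrow> complex fps) \<Rightarrow> bool" where
  "graded e F \<longleftrightarrow> (\<forall>n. biv_poly (2 * n + e) (\<lambda>N a. fps_nth (F N a) n))"

lemma graded_const: "graded 0 (\<lambda>N a. f)"
  by (simp add: graded_def biv_poly.const)

lemma graded_mult:
  assumes "graded d F" "graded e G"
  shows "graded (d + e) (\<lambda>N a. F N a * G N a)"
  unfolding graded_def fps_mult_nth
proof (intro allI biv_poly_sum)
  fix n i :: nat assume "i \<in> {0..n}"
  then have eq: "2 * i + d + (2 * (n - i) + e) = 2 * n + (d + e)" by auto
  have "biv_poly (2 * i + d + (2 * (n - i) + e)) (\<lambda>N a. fps_nth (F N a) i * fps_nth (G N a) (n - i))"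
    using assms by (intro biv_poly_mult) (simp_all add: graded_def)
  then show "biv_poly (2 * n + (d + e)) (\<lambda>N a. fps_nth (F N a) i * fps_nth (G N a) (n - i))"
    unfolding eq .
qed

lemma graded_mult0:
  assumes "graded 0 F" "graded 0 G"
  shows "graded 0 (\<lambda>N a. F N a * G N a)"
  using graded_mult[OF assms] by simp

lemma graded_prod:
  assumes "\<And>i. i \<in> I \<Longrightarrow> graded 0 (F i)"
  shows "graded 0 (\<lambda>N a. \<Prod>i\<in>I. F i N a)"
  using assms
  by (induction I rule: infinite_finite_induct) (auto intro: graded_const graded_mult0)

lemma graded_X_mult:
  assumes "graded 2 F"
  shows "graded 0 (\<lambda>N a. fps_X * F N a)"
  unfolding graded_def
proof
  fix n
  show "biv_poly (2 * n + 0) (\<lambda>N a. fps_nth (fps_X * F N a) n)"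
  proof (cases n)
    case 0
    then show ?thesis by (simp add: biv_poly.const)
  next
    case (Suc m)
    then show ?thesis using assms by (simp add: graded_def)
  qed
qed

lemma graded_exp:
  assumes "biv_poly 2 f"
  shows "graded 0 (\<lambda>N a. fps_exp (f N a))"
  unfolding graded_def
proof
  fix n
  have "biv_poly (n * 2) (\<lambda>N a. (1 / fact n) * f N a ^ n)"
    by (intro biv_poly_cmult biv_poly_power assms)
  then show "biv_poly (2 * n + 0) (\<lambda>N a. fps_nth (fps_exp (f N a)) n)"
    by (simp add: mult.commute)
qed

section \<open>Quantum numbers\<close>

text \<open>
  \<open>qdiff x = (exp(x h/2) - exp(-x h/2)) / h\<close>.
\<close>

definition qdiff :: "complex \<Rightarrow> complex fps" where
  "qdiff x = Abs_fps (\<lambda>n. ((x / 2) ^ Suc n - (- x / 2) ^ Suc n) / fact (Suc n))"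

lemma fps_exp_diff: "fps_exp (x / 2) - fps_exp (- x / 2) = fps_X * qdiff x"
proof (rule fps_ext)
  fix n
  show "fps_nth (fps_exp (x / 2) - fps_exp (- x / 2)) n = fps_nth (fps_X * qdiff x) n"
    by (cases n) (simp_all add: qdiff_def diff_divide_distrib del: power_Suc fact_Suc)
qed

text \<open>
  \<open>q^(1/2) - q^(-1/2) = 2 sinh(h/2)\<close>.
\<close>

definition qh :: "complex fps" where
  "qh = fps_exp (1/2) - fps_exp (- 1/2)"

lemma qh_eq: "qh = fps_X * qdiff 1"
  using fps_exp_diff[of 1] by (simp add: qh_def)

lemma qdiff_1_0: "fps_nth (qdiff 1) 0 = 1"
  by (simp add: qdiff_def)

lemma qdiff_1_nz: "qdiff 1 \<noteq> 0"
  using qdiff_1_0 by auto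

text \<open>
  The quantum number \<open>[x] = sinh(x h/2) / sinh(h/2)\<close> for complex \<open>x\<close>.
\<close>

definition qnum :: "complex \<Rightarrow> complex fps" where
  "qnum x = (fps_exp (x / 2) - fps_exp (- x / 2)) / qh"

lemma qnum_eq: "qnum x = qdiff x * inverse (qdiff 1)"
proof -
  have "qnum x = qdiff x / qdiff 1"
    unfolding qnum_def fps_exp_diff qh_eq by simp
  then show ?thesis
    using qdiff_1_0 by (simp add: fps_divide_unit)
qed

lemma qnum_0 [simp]: "qnum 0 = 0"
  by (simp add: qnum_def)

lemma qint_eq: "qint n = qnum (of_nat n)"
  by (simp add: qint_def qnum_def qh_def)

lemma qnum_mult_qh: "qnum x * qh = fps_exp (x / 2) - fps_exp (- x / 2)"
proof -
  have "qnum x * qh = fps_X * qdiff x * (inverse (qdiff 1) * qdiff 1)"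
    unfolding qnum_eq qh_eq by (simp add: mult_ac)
  then show ?thesis
    unfolding fps_exp_diff using qdiff_1_0 by (simp add: inverse_mult_eq_1)
qed

lemma qh_nz: "qh \<noteq> 0"
  unfolding qh_eq using qdiff_1_nz by simp

lemma qint_sum: "qint n = (\<Sum>i<n. fps_exp ((of_nat n - 1) / 2 - of_nat i))"
proof -
  have "fps_exp ((of_nat n - 1) / 2 - of_nat i) * qh =
      fps_exp (of_nat n / 2 - of_nat i) - fps_exp (of_nat n / 2 - of_nat (Suc i) :: complex)" for i
    by (simp add: qh_def algebra_simps diff_divide_distrib flip: fps_exp_add_mult)
  then have "(\<Sum>i<n. fps_exp ((of_nat n - 1) / 2 - of_nat i)) * qh =
      (\<Sum>i<n. fps_exp (of_nat n / 2 - of_nat i) - fps_exp (of_nat n / 2 - of_nat (Suc i) :: complex))"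
    by (simp only: sum_distrib_right)
  also have "\<dots> = fps_exp (of_nat n / 2) - fps_exp (of_nat n / 2 - of_nat n)"
    using sum_lessThan_telescope'[of "\<lambda>i. fps_exp (of_nat n / 2 - of_nat i :: complex)" n] by simp
  also have "of_nat n / 2 - of_nat n = (- of_nat n / 2 :: complex)"
    by simp
  also have "fps_exp (of_nat n / 2) - fps_exp (- of_nat n / 2) = qint n * qh"
    unfolding qint_eq qnum_mult_qh ..
  finally show ?thesis
    using qh_nz by simp
qed

lemma qint_nth_0: "fps_nth (qint n) 0 = of_nat n"
  by (simp add: qint_sum fps_sum_nth)

lemma qfact_nth_0: "fps_nth (qfact k) 0 = fact k"
proof -
  have "fps_nth (qfact k) 0 = (\<Prod>j=1..k. fps_nth (qint j) 0)"
    unfolding qfact_def by (simp add: fps_nth_power_0 fps_prod_nth')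
  then show ?thesis by (simp add: qint_nth_0 fact_prod)
qed

lemma graded_qnum:
  assumes "biv_poly 1 f"
  shows "graded 1 (\<lambda>N a. qnum (f N a))"
proof -
  have "graded 1 (\<lambda>N a. qdiff (f N a))"
    unfolding graded_def
  proof
    fix n
    define c :: complex where "c = ((1/2) ^ Suc n - (- (1/2)) ^ Suc n) / fact (Suc n)"
    have "biv_poly (Suc n * 1) (\<lambda>N a. c * f N a ^ Suc n)"
      by (intro biv_poly_cmult biv_poly_power assms)
    moreover have "fps_nth (qdiff x) n = c * x ^ Suc n" for x
    proof -
      have "(x / 2) ^ Suc n = (1/2) ^ Suc n * x ^ Suc n" "(- x / 2) ^ Suc n = (- (1/2)) ^ Suc n * x ^ Suc n"
        by (simp_all only: power_mult_distrib[symmetric]) simp_all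
      then show ?thesis
        by (simp only: qdiff_def fps_nth_Abs_fps c_def left_diff_distrib times_divide_eq_left)
    qed
    ultimately show "biv_poly (2 * n + 1) (\<lambda>N a. fps_nth (qdiff (f N a)) n)"
      by (auto intro: biv_poly_mono)
  qed
  from graded_mult[OF this graded_const[of "inverse (qdiff 1)"]] show ?thesis
    by (simp add: qnum_eq)
qed

text \<open>
  Each \<open>[x]\<close> is off by one degree; the factor \<open>q^(1/2) - q^(-1/2)\<close>, divisible by \<open>h\<close>, compensates
  for two of them.
\<close>

lemma graded_qnum_pair:
  assumes "biv_poly 1 f" "biv_poly 1 g"
  shows "graded 0 (\<lambda>N a. qh * (qnum (f N a) * qnum (g N a)))"
proof -
  have "graded (1 + 1) (\<lambda>N a. qnum (f N a) * qnum (g N a))"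
    by (intro graded_mult graded_qnum assms)
  then have "graded 0 (\<lambda>N a. qdiff 1 * (fps_X * (qnum (f N a) * qnum (g N a))))"
    by (intro graded_mult0 graded_const graded_X_mult) (simp add: numeral_2_eq_2)
  then show ?thesis by (simp add: qh_eq mult_ac)
qed

section \<open>Truncated norms of power series\<close>

text \<open>
  The weighted l1-norm of the terms of degree at most \<open>n\<close>. It is submultiplicative, and the
  truncation removes any question of convergence.
\<close>

definition tnorm :: "nat \<Rightarrow> real \<Rightarrow> complex fps \<Rightarrow> real" where
  "tnorm n r f = (\<Sum>m\<le>n. norm (fps_nth f m) * r ^ m)"

lemma tnorm_nonneg: "0 \<le> r \<Longrightarrow> 0 \<le> tnorm n r f"
  by (simp add: tnorm_def sum_nonneg)

lemma tnorm_0 [simp]: "tnorm n r 0 = 0"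
  by (simp add: tnorm_def)

lemma tnorm_const [simp]: "tnorm n r (fps_const c) = norm c"
proof -
  have "tnorm n r (fps_const c) = (\<Sum>m\<le>n. if m = 0 then norm c else 0)"
    unfolding tnorm_def by (rule sum.cong) auto
  then show ?thesis by simp
qed

lemma tnorm_1 [simp]: "tnorm n r 1 = 1"
  using tnorm_const[of n r 1] by simp

lemma tnorm_uminus [simp]: "tnorm n r (- f) = tnorm n r f"
  by (simp add: tnorm_def)

lemma tnorm_add: "0 \<le> r \<Longrightarrow> tnorm n r (f + g) \<le> tnorm n r f + tnorm n r g"
  unfolding tnorm_def sum.distrib[symmetric]
  by (rule sum_mono) (simp add: distrib_right[symmetric] mult_right_mono norm_triangle_ineq)

lemma tnorm_sum:
  assumes "0 \<le> r"
  shows "tnorm n r (\<Sum>i\<in>I. f i) \<le> (\<Sum>i\<in>I. tnorm n r (f i))"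
proof (induction I rule: infinite_finite_induct)
  case (insert i I)
  then show ?case using tnorm_add[OF assms, of n "f i" "\<Sum>i\<in>I. f i"] by simp
qed auto

lemma tnorm_mult:
  assumes "0 \<le> r"
  shows "tnorm n r (f * g) \<le> tnorm n r f * tnorm n r g"
proof -
  define u where "u i = norm (fps_nth f i) * r ^ i" for i
  define v where "v i = norm (fps_nth g i) * r ^ i" for i
  have uv: "0 \<le> u i" "0 \<le> v i" for i
    using assms by (simp_all add: u_def v_def)
  have "tnorm n r (f * g) \<le> (\<Sum>m\<le>n. \<Sum>i\<le>m. u i * v (m - i))"
    unfolding tnorm_def
  proof (rule sum_mono)
    fix m
    have "norm (fps_nth (f * g) m) * r ^ m \<le> (\<Sum>i\<le>m. norm (fps_nth f i * fps_nth g (m - i))) * r ^ m"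
      unfolding fps_mult_nth atLeast0AtMost using assms by (intro mult_right_mono norm_sum) auto
    also have "\<dots> = (\<Sum>i\<le>m. u i * v (m - i))"
      unfolding sum_distrib_right
    proof (rule sum.cong)
      fix i assume "i \<in> {..m}"
      then have "r ^ m = r ^ i * r ^ (m - i)" by (simp flip: power_add)
      then show "norm (fps_nth f i * fps_nth g (m - i)) * r ^ m = u i * v (m - i)"
        by (simp add: u_def v_def norm_mult)
    qed simp
    finally show "norm (fps_nth (f * g) m) * r ^ m \<le> (\<Sum>i\<le>m. u i * v (m - i))" .
  qed
  also have "\<dots> = (\<Sum>(i, j)\<in>{(i, j). i + j \<le> n}. u i * v j)"
    by (rule sum.triangle_reindex_eq[symmetric])
  also have "\<dots> \<le> (\<Sum>(i, j)\<in>{..n} \<times> {..n}. u i * v j)"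
    by (rule sum_mono2) (use uv in auto)
  also have "\<dots> = tnorm n r f * tnorm n r g"
    unfolding tnorm_def u_def v_def by (simp add: sum_product sum.cartesian_product)
  finally show ?thesis .
qed

lemma tnorm_mult_le:
  assumes "0 \<le> r" "tnorm n r f \<le> x" "tnorm n r g \<le> y"
  shows "tnorm n r (f * g) \<le> x * y"
proof -
  have "tnorm n r f * tnorm n r g \<le> x * y"
    using assms tnorm_nonneg[OF assms(1)] by (intro mult_mono) (auto intro: order_trans)
  then show ?thesis using tnorm_mult[OF assms(1), of n f g] by linarith
qed

lemma tnorm_prod_le:
  assumes "0 \<le> r" "\<And>i. i \<in> I \<Longrightarrow> tnorm n r (f i) \<le> x i"
  shows "tnorm n r (\<Prod>i\<in>I. f i) \<le> (\<Prod>i\<in>I. x i)"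
  using assms(2)
  by (induction I rule: infinite_finite_induct) (auto intro: tnorm_mult_le[OF assms(1)])

lemma tnorm_power_le:
  assumes "0 \<le> r" "tnorm n r f \<le> x"
  shows "tnorm n r (f ^ k) \<le> x ^ k"
  using tnorm_prod_le[of r "{..<k}" n "\<lambda>_. f" "\<lambda>_. x"] assms by simp

lemma tnorm_X_mult:
  assumes "0 \<le> r"
  shows "tnorm n r (fps_X * f) \<le> r * tnorm n r f"
proof (cases n)
  case 0
  then show ?thesis using tnorm_nonneg[OF assms, of n f] assms by (simp add: tnorm_def)
next
  case (Suc m)
  have "tnorm n r (fps_X * f) = r * tnorm m r f"
    unfolding tnorm_def Suc sum.atMost_Suc_shift by (simp add: sum_distrib_left mult_ac)
  also have "\<dots> \<le> r * tnorm n r f"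
    using assms by (intro mult_left_mono) (auto simp: tnorm_def Suc)
  finally show ?thesis .
qed

lemma tnorm_le_exp:
  assumes "0 \<le> r" "0 \<le> x" "\<And>m. norm (fps_nth f m) \<le> x ^ m / fact m"
  shows "tnorm n r f \<le> exp (x * r)"
proof -
  have "tnorm n r f \<le> (\<Sum>m\<le>n. (x * r) ^ m / fact m)"
    unfolding tnorm_def
  proof (rule sum_mono)
    fix m
    have "norm (fps_nth f m) * r ^ m \<le> x ^ m / fact m * r ^ m"
      using assms by (intro mult_right_mono) auto
    then show "norm (fps_nth f m) * r ^ m \<le> (x * r) ^ m / fact m"
      by (simp add: power_mult_distrib)
  qed
  also have "\<dots> \<le> (\<Sum>m. (x * r) ^ m / fact m)"
    using assms summable_exp[of "x * r"]
    by (intro sum_le_suminf) (auto simp: field_simps)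
  also have "\<dots> = exp (x * r)"
    by (simp add: exp_def field_simps)
  finally show ?thesis .
qed

lemma tnorm_exp:
  assumes "0 \<le> r" "norm c \<le> x"
  shows "tnorm n r (fps_exp c) \<le> exp (x * r)"
  using assms order_trans[OF norm_ge_zero assms(2)]
  by (intro tnorm_le_exp) (auto simp: norm_divide norm_power divide_right_mono power_mono
      intro: order_trans)

lemma tnorm_exp_minus_1:
  assumes "0 \<le> r" "norm c \<le> x"
  shows "tnorm n r (fps_exp c - 1) \<le> exp (x * r) - 1"
proof -
  have "tnorm n r (fps_exp c - 1) = tnorm n r (fps_exp c) - 1"
    by (simp add: tnorm_def sum.atMost_shift)
  then show ?thesis using tnorm_exp[OF assms, of n] by simp
qed

text \<open>
  From \<open>f g = 1\<close> and \<open>f = c + u\<close> with \<open>u\<close> small, \<open>c |g| \<le> 1 + |u| |g|\<close>.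
\<close>

lemma tnorm_inverse:
  assumes "0 \<le> r" "0 < c" "tnorm n r (f - fps_const (of_real c)) \<le> c / 2" "fps_nth f 0 \<noteq> 0"
  shows "tnorm n r (inverse f) \<le> 2 / c"
proof -
  let ?g = "inverse f" and ?u = "f - fps_const (of_real c)"
  have "f * ?g = 1"
    using assms(4) by (simp add: inverse_mult_eq_1')
  then have "fps_const (of_real c) * ?g = 1 + - (?u * ?g)"
    by (simp add: algebra_simps)
  then have "tnorm n r (fps_const (of_real c) * ?g) \<le> 1 + tnorm n r (?u * ?g)"
    using tnorm_add[OF assms(1), of n 1 "- (?u * ?g)"] by simp
  also have "tnorm n r (?u * ?g) \<le> c / 2 * tnorm n r ?g"
    by (intro tnorm_mult_le assms order_refl)
  also have "tnorm n r (fps_const (of_real c) * ?g) = c * tnorm n r ?g"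
    using assms(2) by (simp add: tnorm_def norm_mult sum_distrib_left mult_ac)
  finally show ?thesis
    using assms(2) by (simp add: field_simps)
qed

lemma norm_nth_le_tnorm:
  assumes "0 < r"
  shows "norm (fps_nth f n) \<le> tnorm n r f / r ^ n"
proof -
  have "norm (fps_nth f n) * r ^ n \<le> tnorm n r f"
    unfolding tnorm_def using assms by (intro member_le_sum) auto
  then show ?thesis using assms by (simp add: field_simps)
qed

lemma tnorm_qh:
  assumes "0 \<le> r" "r \<le> 1"
  shows "tnorm n r qh \<le> r * exp 1"
proof -
  have "norm (fps_nth (qdiff 1) m) \<le> 1 ^ m / fact m" for m
  proof -
    have "norm ((1/2) ^ Suc m - (- 1/2) ^ Suc m :: complex) \<le> (1/2) ^ Suc m + (1/2) ^ Suc m"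
      using norm_triangle_ineq4[of "(1/2) ^ Suc m :: complex" "(- 1/2) ^ Suc m"]
      by (simp add: norm_power norm_divide norm_mult)
    also have "\<dots> = (1/2 :: real) ^ m" by simp
    also have "\<dots> \<le> 1" by (simp add: power_le_one)
    finally have "norm (fps_nth (qdiff 1) m) \<le> 1 / fact (Suc m)"
      by (simp add: qdiff_def norm_divide divide_right_mono del: power_Suc fact_Suc of_nat_Suc)
    also have "\<dots> \<le> 1 / fact m"
      by (intro divide_left_mono fact_mono mult_pos_pos) simp_all
    finally show ?thesis by simp
  qed
  then have "tnorm n r (qdiff 1) \<le> exp (1 * r)"
    by (intro tnorm_le_exp assms) auto
  also have "\<dots> \<le> exp 1" using assms by simp
  finally have "r * tnorm n r (qdiff 1) \<le> r * exp 1"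
    using assms by (intro mult_left_mono) auto
  then show ?thesis
    using tnorm_X_mult[OF assms(1), of n "qdiff 1"] by (simp add: qh_eq)
qed

lemma norm_qint_exponent: "i < m \<Longrightarrow> norm ((of_nat m - 1) / 2 - of_nat i :: complex) \<le> of_nat m / 2"
proof -
  assume "i < m"
  have "(of_nat m - 1) / 2 - of_nat i = (of_real ((real m - 1) / 2 - real i) :: complex)"
    by simp
  then have "norm ((of_nat m - 1) / 2 - of_nat i :: complex) = \<bar>(real m - 1) / 2 - real i\<bar>"
    by (metis norm_of_real real_norm_def)
  then show ?thesis using \<open>i < m\<close> by (simp add: abs_if field_simps)
qed

lemma tnorm_qint:
  assumes "0 \<le> r"
  shows "tnorm n r (qint m) \<le> real m * exp (real m / 2 * r)"
proof -
  have "tnorm n r (qint m) \<le> (\<Sum>i<m. tnorm n r (fps_exp ((of_nat m - 1) / 2 - of_nat i)))"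
    unfolding qint_sum by (rule tnorm_sum[OF assms])
  also have "\<dots> \<le> (\<Sum>i<m. exp (real m / 2 * r))"
    by (intro sum_mono tnorm_exp assms norm_qint_exponent) simp
  finally show ?thesis by simp
qed

lemma tnorm_inverse_qint:
  assumes "0 \<le> r" "0 < m" "real m * r \<le> 1 / 2"
  shows "tnorm n r (inverse (qint m)) \<le> 2 / real m"
proof (rule tnorm_inverse[OF assms(1)])
  have "qint m - fps_const (of_real (real m)) =
      (\<Sum>i<m. fps_exp ((of_nat m - 1) / 2 - of_nat i) - 1)"
    by (simp add: qint_sum sum_subtractf fps_of_nat)
  then have "tnorm n r (qint m - fps_const (of_real (real m))) \<le>
      (\<Sum>i<m. tnorm n r (fps_exp ((of_nat m - 1) / 2 - of_nat i) - 1))"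
    by (simp only: tnorm_sum[OF assms(1)])
  also have "\<dots> \<le> (\<Sum>i<m. exp (real m / 2 * r) - 1)"
    by (intro sum_mono tnorm_exp_minus_1 assms norm_qint_exponent) simp
  also have "\<dots> \<le> (\<Sum>i<m. 1 / 2)"
  proof (intro sum_mono)
    have "exp (real m / 2 * r) \<le> exp (1 / 4)" using assms(3) by (simp add: mult.commute)
    also have "\<dots> \<le> 1 + 1 / 4 + (1 / 4)\<^sup>2" by (rule exp_bound) auto
    finally show "exp (real m / 2 * r) - 1 \<le> 1 / 2" by (simp add: power2_eq_square)
  qed
  finally show "tnorm n r (qint m - fps_const (of_real (real m))) \<le> real m / 2"
    by simp
qed (use assms in \<open>auto simp: qint_nth_0\<close>)

section \<open>Crossings with integer labels\<close>

text \<open>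
  The weight of \<open>e_j\<close>, for all integers \<open>j\<close>. The formulas for the entries of the crossings make sense for
  integer labels outside \<open>[0, N]\<close>, too.
\<close>

definition int_weight :: "nat \<Rightarrow> int \<Rightarrow> complex" where
  "int_weight N j = of_nat N - 2 * of_int j"

text \<open>
  The \<open>k\<close>-th summand of the R-matrix and, up to sign, of its inverse, without the powers of \<open>q\<close>:
  \<open>(q^(1/2) - q^(-1/2))^k / [k]!\<close> times the coefficient of \<open>e_i\<close> in \<open>E^k e_(i+k)\<close> and that of \<open>e_(b+k)\<close> in
  \<open>F^k e_b\<close>.
\<close>

definition crossing_term :: "nat \<Rightarrow> int \<Rightarrow> int \<Rightarrow> nat \<Rightarrow> complex fps" where
  "crossing_term N i b k = qh ^ k * inverse (qfact k) *
     ((\<Prod>l=1..k. qnum (of_nat N - of_int (i + int l) + 1)) * (\<Prod>l=1..k. qnum (of_int (b + int l))))"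

lemma qnum_of_int_bound:
  assumes "0 \<le> r" "real M * r \<le> 1 / 2" "0 \<le> x" "x \<le> int M"
  shows "tnorm n r (qnum (of_int x)) \<le> real M * exp 1"
proof -
  have x: "x = int (nat x)" "nat x \<le> M" using assms by auto
  have "of_int x = (of_nat (nat x) :: complex)"
    using assms(3) by simp
  then have "tnorm n r (qnum (of_int x)) \<le> real (nat x) * exp (real (nat x) / 2 * r)"
    using tnorm_qint[OF assms(1), of n "nat x"] by (simp only: qint_eq)
  also have "\<dots> \<le> real M * exp 1"
  proof (intro mult_mono)
    have "real (nat x) * r \<le> real M * r" using x assms(1) by (intro mult_right_mono) auto
    then show "exp (real (nat x) / 2 * r) \<le> exp 1" using assms(2) by simp
  qed (use x in auto)
  finally show ?thesis .
qed

lemma exp_ge_power_div_fact: "0 \<le> x \<Longrightarrow> x ^ k / fact k \<le> exp (x :: real)"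
proof -
  assume "0 \<le> x"
  have "(\<Sum>m\<in>{k}. x ^ m / fact m) \<le> (\<Sum>m. x ^ m / fact m)"
    using \<open>0 \<le> x\<close> summable_exp[of x] by (intro sum_le_suminf) (auto simp: field_simps)
  also have "\<dots> = exp x" by (simp add: exp_def field_simps)
  finally show ?thesis by simp
qed

text \<open>
  The \<open>k\<close> factors \<open>q^(1/2) - q^(-1/2)\<close> are of size \<open>1/n\<close>, the \<open>2 k\<close> quantum integers are of size \<open>n\<close>, and
  \<open>1 / [k]!\<close> is of size \<open>2^k / k!\<close>: the product is \<open>(c n)^k / k! \<le> exp(c n)\<close>.
\<close>

lemma tnorm_crossing_term:
  assumes n: "1 \<le> n" "N \<le> 2 * n" and r: "r = 1 / (4 * real n)"
    and rng: "0 \<le> i" "i + int k \<le> int N" "0 \<le> b" "b + int k \<le> int N"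
  shows "tnorm n r (crossing_term N i b k) \<le> exp (2 * exp 3) ^ n"
proof -
  have r0: "0 \<le> r" "r \<le> 1" and Nr: "real (2 * n) * r \<le> 1 / 2"
    using n by (simp_all add: r divide_simps)
  have kn: "k \<le> 2 * n" using rng n by linarith
  have 1: "tnorm n r (qh ^ k) \<le> (r * exp 1) ^ k"
    by (intro tnorm_power_le tnorm_qh r0)
  have 2: "tnorm n r (inverse (qfact k)) \<le> 2 ^ k / fact k"
  proof -
    have "inverse (qfact k) = (\<Prod>j=1..k. inverse (qint j))"
      unfolding qfact_def by (induction k) (simp_all add: fps_inverse_mult)
    moreover have "tnorm n r (\<Prod>j=1..k. inverse (qint j)) \<le> (\<Prod>j=1..k. 2 / real j)"
    proof (intro tnorm_prod_le r0 tnorm_inverse_qint)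
      fix j assume "j \<in> {1..k}"
      then have "real j * r \<le> real (2 * n) * r" using kn r0 by (intro mult_right_mono) auto
      then show "real j * r \<le> 1 / 2" using Nr by linarith
    qed auto
    ultimately show ?thesis by (simp add: prod_dividef fact_prod)
  qed
  have 3: "tnorm n r (\<Prod>l=1..k. qnum (of_nat N - of_int (i + int l) + 1)) \<le> (real (2 * n) * exp 1) ^ k"
  proof -
    have "tnorm n r (\<Prod>l=1..k. qnum (of_nat N - of_int (i + int l) + 1)) \<le>
        (\<Prod>l=1..k. real (2 * n) * exp 1)"
    proof (intro tnorm_prod_le r0)
      fix l assume l: "l \<in> {1..k}"
      have "of_nat N - of_int (i + int l) + 1 = (of_int (int N - (i + int l) + 1) :: complex)"
        by simp
      then show "tnorm n r (qnum (of_nat N - of_int (i + int l) + 1)) \<le> real (2 * n) * exp 1"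
        using qnum_of_int_bound[OF r0(1) Nr, of "int N - (i + int l) + 1" n] rng l n by simp
    qed
    then show ?thesis by simp
  qed
  have 4: "tnorm n r (\<Prod>l=1..k. qnum (of_int (b + int l))) \<le> (real (2 * n) * exp 1) ^ k"
  proof -
    have "tnorm n r (\<Prod>l=1..k. qnum (of_int (b + int l))) \<le> (\<Prod>l=1..k. real (2 * n) * exp 1)"
      using rng n by (intro tnorm_prod_le r0 qnum_of_int_bound Nr) auto
    then show ?thesis by simp
  qed
  have "tnorm n r (crossing_term N i b k) \<le>
      (r * exp 1) ^ k * (2 ^ k / fact k) * ((real (2 * n) * exp 1) ^ k * (real (2 * n) * exp 1) ^ k)"
    unfolding crossing_term_def by (intro tnorm_mult_le r0 1 2 3 4)
  also have "\<dots> = (r * exp 1 * 2 * (real (2 * n) * exp 1) * (real (2 * n) * exp 1)) ^ k / fact k"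
    by (simp only: power_mult_distrib mult_ac times_divide_eq_left times_divide_eq_right)
  also have "r * exp 1 * 2 * (real (2 * n) * exp 1) * (real (2 * n) * exp 1) = real n * (2 * exp 3)"
  proof -
    have "exp 1 * exp 1 * exp 1 = exp (3 :: real)"
      by (simp flip: exp_add)
    then show ?thesis using n by (simp add: r field_simps)
  qed
  also have "(real n * (2 * exp 3)) ^ k / fact k \<le> exp (real n * (2 * exp 3))"
    by (rule exp_ge_power_div_fact) simp
  also have "\<dots> = exp (2 * exp 3) ^ n" by (rule exp_of_nat_mult)
  finally show ?thesis .
qed

lemma X_power_dvd_crossing_term: "fps_X ^ k dvd crossing_term N i b k"
  unfolding crossing_term_def qh_eq power_mult_distrib by (simp add: mult.assoc)

text \<open>
  The factor \<open>[0]\<close> in \<open>E e_(N+1) = [0] e_N\<close> and \<open>F e_(-1) = [0] e_0\<close>: a label above \<open>N\<close> stays above \<open>N\<close>,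
  and a negative label stays negative.
\<close>

lemma crossing_term_source_gt:
  assumes "crossing_term N i b k \<noteq> 0" "int N < i + int k"
  shows "int N < i"
proof (rule ccontr)
  assume "\<not> int N < i"
  \<comment> \<open>The factor for the step from \<open>N + 1\<close> to \<open>N\<close>.\<close>
  define l where "l = nat (int N + 1 - i)"
  have "l \<in> {1..k}" "of_nat N - of_int (i + int l) + 1 = (0 :: complex)"
    using assms(2) \<open>\<not> int N < i\<close> by (auto simp: l_def)
  then have "(\<Prod>l=1..k. qnum (of_nat N - of_int (i + int l) + 1)) = 0"
    by (metis finite_atLeastAtMost prod_zero qnum_0)
  then show False using assms(1) by (simp add: crossing_term_def)
qed

lemma crossing_term_target_neg:
  assumes "crossing_term N i b k \<noteq> 0" "b < 0"
  shows "b + int k < 0"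
proof (rule ccontr)
  assume "\<not> b + int k < 0"
  \<comment> \<open>The factor for the step from \<open>-1\<close> to \<open>0\<close>.\<close>
  define l where "l = nat (- b)"
  have "l \<in> {1..k}" "of_int (b + int l) = (0 :: complex)"
    using assms(2) \<open>\<not> b + int k < 0\<close> by (auto simp: l_def)
  then have "(\<Prod>l=1..k. qnum (of_int (b + int l))) = 0"
    by (metis finite_atLeastAtMost prod_zero qnum_0)
  then show False using assms(1) by (simp add: crossing_term_def)
qed

lemma graded_crossing_term: "graded 0 (\<lambda>N a. crossing_term N (i + int a) (b + int a) k)"
proof -
  have "biv_poly 1 (\<lambda>N a. of_nat N - of_int (i + int a + int l) + 1)" for l
    using biv_poly_linear[of 1 "- 1" "1 - of_int i - of_nat l"] by (simp add: algebra_simps)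
  moreover have "biv_poly 1 (\<lambda>N a. of_int (b + int a + int l))" for l
    using biv_poly_linear[of 0 1 "of_int b + of_nat l"] by (simp add: algebra_simps)
  ultimately have "graded 0 (\<lambda>N a. inverse (qfact k) * (\<Prod>l=1..k. qh *
      (qnum (of_nat N - of_int (i + int a + int l) + 1) * qnum (of_int (b + int a + int l)))))"
    by (intro graded_mult0 graded_const graded_prod graded_qnum_pair)
  then show ?thesis
    by (simp add: crossing_term_def prod.distrib mult_ac)
qed

text \<open>
  The coefficient of \<open>e_i \<otimes> e_j\<close> in \<open>R (e_a \<otimes> e_b)\<close> for integer labels. Only the summand with
  \<open>k = a - i = j - b\<close> contributes.
\<close>

definition R_int :: "nat \<Rightarrow> int \<Rightarrow> int \<Rightarrow> int \<Rightarrow> int \<Rightarrow> complex fps" where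
  "R_int N i j a b = (if i \<le> a \<and> a - i = j - b then
     let k = nat (a - i) in
       fps_exp (int_weight N i * int_weight N j / 4) * fps_exp (of_nat k * (of_nat k - 1) / 4) * crossing_term N i b k
     else 0)"

text \<open>
  The same for the inverse of the R-matrix.
\<close>

definition Rinv_int :: "nat \<Rightarrow> int \<Rightarrow> int \<Rightarrow> int \<Rightarrow> int \<Rightarrow> complex fps" where
  "Rinv_int N i j a b = (if i \<le> a \<and> a - i = j - b then
     let k = nat (a - i) in
       (- 1) ^ k * fps_exp (- int_weight N a * int_weight N b / 4) * fps_exp (- of_nat k * (of_nat k - 1) / 4) * crossing_term N i b k
     else 0)"

text \<open>
  The operators of elementary tangles and of layers for integer labels.
\<close>

primrec elem_int :: "nat \<Rightarrow> elem \<Rightarrow> int list \<Rightarrow> int list \<Rightarrow> complex fps" where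
  "elem_int N CapDU t s = (if s ! 0 = s ! 1 then 1 else 0)"
| "elem_int N CapUD t s = (if s ! 0 = s ! 1 then fps_exp (int_weight N (s ! 0) / 2) else 0)"
| "elem_int N CupUD t s = (if t ! 0 = t ! 1 then 1 else 0)"
| "elem_int N CupDU t s = (if t ! 0 = t ! 1 then fps_exp (- int_weight N (t ! 0) / 2) else 0)"
| "elem_int N Pos t s = R_int N (t ! 1) (t ! 0) (s ! 0) (s ! 1)"
| "elem_int N Neg t s = Rinv_int N (t ! 0) (t ! 1) (s ! 1) (s ! 0)"

fun layer_int :: "nat \<Rightarrow> layer \<Rightarrow> int list \<Rightarrow> int list \<Rightarrow> complex fps" where
  "layer_int N (l, e, r) t s =
     (let a = length l; m = length (elem_src e); n = length (elem_tgt e) in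
      if take a t = take a s \<and> drop (a + n) t = drop (a + m) s
      then elem_int N e (take n (drop a t)) (take m (drop a s)) else 0)"

lemma rep_E_power:
  assumes "i \<le> N" "j \<le> N"
  shows "(rep_E N ^\<^sub>m k) $$ (i, j) =
    (if j = i + k then \<Prod>l=1..k. qnum (of_nat N - of_int (int i + int l) + 1) else 0)"
  using assms
proof (induction k arbitrary: j)
  case 0
  then show ?case by (simp add: rep_E_def)
next
  case (Suc k)
  have dim: "rep_E N \<in> carrier_mat (N + 1) (N + 1)" "rep_E N ^\<^sub>m k \<in> carrier_mat (N + 1) (N + 1)"
    by (simp_all add: rep_E_def)
  have "(rep_E N ^\<^sub>m Suc k) $$ (i, j) = (\<Sum>m\<in>{0..<N + 1}. (rep_E N ^\<^sub>m k) $$ (i, m) * rep_E N $$ (m, j))"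
    using dim Suc.prems by (simp add: scalar_prod_def)
  also have "\<dots> = (\<Sum>m\<in>{0..<N + 1}. if m = i + k then
      (if j = i + Suc k then (\<Prod>l=1..k. qnum (of_nat N - of_int (int i + int l) + 1)) * qint (N - j + 1) else 0) else 0)"
  proof (intro sum.cong refl)
    fix m assume "m \<in> {0..<N + 1}"
    then show "(rep_E N ^\<^sub>m k) $$ (i, m) * rep_E N $$ (m, j) = (if m = i + k then
      (if j = i + Suc k then (\<Prod>l=1..k. qnum (of_nat N - of_int (int i + int l) + 1)) * qint (N - j + 1) else 0) else 0)"
      using Suc.IH[of m] Suc.prems by (auto simp: rep_E_def)
  qed
  also have "\<dots> = (if j = i + Suc k then
      (\<Prod>l=1..k. qnum (of_nat N - of_int (int i + int l) + 1)) * qint (N - j + 1) else 0)"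
    using Suc.prems by simp
  also have "\<dots> = (if j = i + Suc k then
      (\<Prod>l=1..Suc k. qnum (of_nat N - of_int (int i + int l) + 1)) else 0)"
    using Suc.prems by (simp add: qint_eq of_nat_diff algebra_simps)
  finally show ?case .
qed

lemma rep_F_power:
  assumes "i \<le> N" "j \<le> N"
  shows "(rep_F N ^\<^sub>m k) $$ (i, j) =
    (if i = j + k then \<Prod>l=1..k. qnum (of_int (int j + int l)) else 0)"
  using assms
proof (induction k arbitrary: j)
  case 0
  then show ?case by (simp add: rep_F_def)
next
  case (Suc k)
  have dim: "rep_F N \<in> carrier_mat (N + 1) (N + 1)" "rep_F N ^\<^sub>m k \<in> carrier_mat (N + 1) (N + 1)"
    by (simp_all add: rep_F_def)
  have "(rep_F N ^\<^sub>m Suc k) $$ (i, j) = (\<Sum>m\<in>{0..<N + 1}. (rep_F N ^\<^sub>m k) $$ (i, m) * rep_F N $$ (m, j))"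
    using dim Suc.prems by (simp add: scalar_prod_def)
  also have "\<dots> = (\<Sum>m\<in>{0..<N + 1}. if m = j + 1 then
      (if i = j + Suc k then (\<Prod>l=1..k. qnum (of_int (int (j + 1) + int l))) * qint (j + 1) else 0) else 0)"
  proof (intro sum.cong refl)
    fix m assume "m \<in> {0..<N + 1}"
    then show "(rep_F N ^\<^sub>m k) $$ (i, m) * rep_F N $$ (m, j) = (if m = j + 1 then
      (if i = j + Suc k then (\<Prod>l=1..k. qnum (of_int (int (j + 1) + int l))) * qint (j + 1) else 0) else 0)"
      using Suc.IH[of m] Suc.prems by (auto simp: rep_F_def)
  qed
  also have "\<dots> = (if i = j + Suc k then
      (\<Prod>l=1..k. qnum (of_int (int (j + 1) + int l))) * qint (j + 1) else 0)"
    using Suc.prems by simp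
  also have "\<dots> = (if i = j + Suc k then (\<Prod>l=1..Suc k. qnum (of_int (int j + int l))) else 0)"
  proof -
    have "(\<Prod>l=1..Suc k. qnum (of_int (int j + int l))) =
        qnum (of_int (int j + int 1)) * (\<Prod>l=1..k. qnum (of_int (int j + int (Suc l))))"
      by (subst prod.atLeast_Suc_atMost, simp, subst prod.shift_bounds_cl_Suc_ivl) simp
    then show ?thesis by (simp add: qint_eq algebra_simps)
  qed
  finally show ?case .
qed

lemma qfact_divide: "f / qfact k = f * inverse (qfact k)"
  by (simp add: fps_divide_unit qfact_nth_0)

lemma nat_int_diff_eq: "nat (int a - int i) = a - i"
  by simp

lemma R_entry_eq:
  assumes "i \<le> N" "j \<le> N" "a \<le> N" "b \<le> N"
  shows "R_entry N i j a b = R_int N (int i) (int j) (int a) (int b)"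
proof -
  define T where "T k = fps_exp (of_nat k * (of_nat k - 1) / 4) * crossing_term N (int i) (int b) k" for k
  have "R_entry N i j a b = fps_exp (int_weight N i * int_weight N j / 4) *
      (\<Sum>k\<le>N. if k = a - i then if i \<le> a \<and> int a - int i = int j - int b then T k else 0 else 0)"
    unfolding R_entry_def
  proof (intro arg_cong2[of _ _ _ _ "(*)"] sum.cong refl)
    fix k assume "k \<in> {..N}"
    show "fps_exp (of_nat k * (of_nat k - 1) / 4) * (fps_exp (1/2) - fps_exp (- 1/2)) ^ k / qfact k
        * (rep_E N ^\<^sub>m k) $$ (i, a) * (rep_F N ^\<^sub>m k) $$ (j, b) =
        (if k = a - i then if i \<le> a \<and> int a - int i = int j - int b then T k else 0 else 0)"
      using assms
      by (auto simp: rep_E_power rep_F_power T_def crossing_term_def qfact_divide qh_def mult_ac)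
  qed (simp_all add: weight_def int_weight_def)
  also have "\<dots> = R_int N (int i) (int j) (int a) (int b)"
  proof (cases "int i \<le> int a \<and> int a - int i = int j - int b")
    case True
    have "R_int N (int i) (int j) (int a) (int b) = fps_exp (int_weight N i * int_weight N j / 4) * T (a - i)"
      unfolding R_int_def if_P[OF True] Let_def nat_int_diff_eq T_def by (simp only: mult.assoc)
    moreover have "a - i \<le> N" using assms by simp
    ultimately show ?thesis using True by simp
  next
    case False
    then show ?thesis by (auto simp: R_int_def)
  qed
  finally show ?thesis .
qed

lemma Rinv_entry_eq:
  assumes "i \<le> N" "j \<le> N" "a \<le> N" "b \<le> N"
  shows "Rinv_entry N i j a b = Rinv_int N (int i) (int j) (int a) (int b)"
proof -
  define T where "T k = (- 1) ^ k * fps_exp (- of_nat k * (of_nat k - 1) / 4) * crossing_term N (int i) (int b) k" for k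
  have "Rinv_entry N i j a b =
      (\<Sum>k\<le>N. if k = a - i then if i \<le> a \<and> int a - int i = int j - int b then T k else 0 else 0)
      * fps_exp (- int_weight N a * int_weight N b / 4)"
    unfolding Rinv_entry_def
  proof (intro arg_cong2[of _ _ _ _ "(*)"] sum.cong refl)
    fix k assume "k \<in> {..N}"
    show "(- 1) ^ k * fps_exp (- of_nat k * (of_nat k - 1) / 4) * (fps_exp (1/2) - fps_exp (- 1/2)) ^ k / qfact k
        * (rep_E N ^\<^sub>m k) $$ (i, a) * (rep_F N ^\<^sub>m k) $$ (j, b) =
        (if k = a - i then if i \<le> a \<and> int a - int i = int j - int b then T k else 0 else 0)"
      using assms
      by (auto simp: rep_E_power rep_F_power T_def crossing_term_def qfact_divide qh_def mult_ac)
  qed (simp_all add: weight_def int_weight_def)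
  also have "\<dots> = Rinv_int N (int i) (int j) (int a) (int b)"
  proof (cases "int i \<le> int a \<and> int a - int i = int j - int b")
    case True
    have "Rinv_int N (int i) (int j) (int a) (int b) = T (a - i) * fps_exp (- int_weight N a * int_weight N b / 4)"
      unfolding Rinv_int_def if_P[OF True] Let_def nat_int_diff_eq T_def by (simp only: mult_ac)
    moreover have "a - i \<le> N" using assms by simp
    ultimately show ?thesis using True by simp
  next
    case False
    then show ?thesis by (auto simp: Rinv_int_def)
  qed
  finally show ?thesis .
qed

lemma all_less_two: "(\<forall>j<Suc (Suc 0). P j) \<longleftrightarrow> P 0 \<and> P (Suc 0)"
  by (auto simp: less_Suc_eq)

lemma length_2_cases: "length s = Suc (Suc 0) \<longleftrightarrow> (\<exists>x y. s = [x, y])"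
  by (auto simp: length_Suc_conv)

lemma elem_op_eq:
  assumes "t \<in> basis N (length (elem_tgt e))" "s \<in> basis N (length (elem_src e))"
  shows "elem_op N e t s = elem_int N e (map int t) (map int s)"
  using assms
  by (cases e) (auto simp: basis_def length_2_cases R_entry_eq Rinv_entry_eq weight_def int_weight_def)

lemma layer_op_eq:
  assumes "t \<in> basis N (length (layer_tgt L))" "s \<in> basis N (length (layer_src L))"
  shows "layer_op N L t s = layer_int N L (map int t) (map int s)"
proof -
  obtain l e r where L: "L = (l, e, r)" by (cases L)
  define a m n where "a = length l" "m = length (elem_src e)" "n = length (elem_tgt e)"
  have "take n (drop a t) \<in> basis N (length (elem_tgt e))" "take m (drop a s) \<in> basis N (length (elem_src e))"
    using assms by (auto simp: basis_def L a_m_n_def dest!: in_set_takeD in_set_dropD)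
  then have e: "elem_op N e (take n (drop a t)) (take m (drop a s)) =
      elem_int N e (take n (drop a (map int t))) (take m (drop a (map int s)))"
    by (simp add: elem_op_eq take_map drop_map)
  have "take a (map int t) = take a (map int s) \<longleftrightarrow> take a t = take a s"
    "drop (a + n) (map int t) = drop (a + m) (map int s) \<longleftrightarrow> drop (a + n) t = drop (a + m) s"
    by (simp_all add: take_map drop_map inj_map_eq_map)
  with e show ?thesis
    unfolding L layer_op.simps layer_int.simps Let_def a_m_n_def[symmetric] by presburger
qed

section \<open>State sums\<close>

text \<open>
  A state lists the labels on the horizontal lines above the layers; the line below the first layer
  is an extra argument of the weight.
\<close>

definition states :: "int set \<Rightarrow> diagram \<Rightarrow> int list list set" where
  "states A D = {us. list_all2 (\<lambda>u L. length u = length (layer_tgt L) \<and> set u \<subseteq> A) us D}"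

text \<open>
  The product of the layer entries, \<open>s\<close> being the labels below the first layer.
\<close>

fun state_wt :: "nat \<Rightarrow> diagram \<Rightarrow> int list \<Rightarrow> int list list \<Rightarrow> complex fps" where
  "state_wt N [] s us = 1"
| "state_wt N (L # D) s us = layer_int N L (hd us) s * state_wt N D (hd us) (tl us)"

lemma states_Nil: "states A [] = {[]}"
  by (auto simp: states_def)

lemma states_Cons:
  "states A (L # D) = (\<lambda>(u, us). u # us) ` ({u. length u = length (layer_tgt L) \<and> set u \<subseteq> A} \<times> states A D)"
  by (auto simp: states_def list_all2_Cons2)

lemma finite_words: "finite A \<Longrightarrow> finite {u. length u = n \<and> set u \<subseteq> A}"
  using finite_lists_length_eq[of A n] by (simp add: conj_commute)

lemma finite_states: "finite A \<Longrightarrow> finite (states A D)"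
proof (induction D)
  case (Cons L D)
  then show ?case unfolding states_Cons by (intro finite_imageI finite_cartesian_product finite_words)
qed (simp add: states_Nil)

lemma card_states:
  assumes "finite A"
  shows "card (states A D) = card A ^ (\<Sum>L\<leftarrow>D. length (layer_tgt L))"
proof (induction D)
  case (Cons L D)
  have "card {u. length u = length (layer_tgt L) \<and> set u \<subseteq> A} = card A ^ length (layer_tgt L)"
    using card_lists_length_eq[OF assms, of "length (layer_tgt L)"] by (simp add: conj_commute)
  moreover have "inj_on (\<lambda>(u, us). u # us) X" for X :: "(int list \<times> int list list) set"
    by (auto simp: inj_on_def)
  ultimately show ?case
    by (simp add: states_Cons card_image card_cartesian_product Cons power_add)
qed (simp add: states_Nil)

lemma states_nth:
  "us \<in> states A D \<longleftrightarrow> length us = length D \<and>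
     (\<forall>k<length D. length (us ! k) = length (layer_tgt (D ! k)) \<and> set (us ! k) \<subseteq> A)"
  by (auto simp: states_def list_all2_conv_all_nth)

lemma diagram_op_eq_sum:
  assumes "composable o1 D []" "s \<in> basis N (length o1)"
  shows "diagram_op N D [] s = (\<Sum>us\<in>states {0..int N} D. state_wt N D (map int s) us)"
  using assms
proof (induction D arbitrary: o1 s)
  case Nil
  then show ?case by (simp add: basis_def states_Nil)
next
  case (Cons L D)
  let ?W = "{u. length u = length (layer_tgt L) \<and> set u \<subseteq> {0..int N}}"
  have W: "?W = map int ` basis N (length (layer_tgt L))"
  proof (intro equalityI subsetI)
    fix u assume u: "u \<in> ?W"
    then have "u = map int (map nat u)" by (auto simp: map_idI subset_iff)
    moreover have "map nat u \<in> basis N (length (layer_tgt L))"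
      using u by (fastforce simp: basis_def nat_le_iff)
    ultimately show "u \<in> map int ` basis N (length (layer_tgt L))" by blast
  qed (fastforce simp: basis_def)
  have "(\<Sum>us\<in>states {0..int N} (L # D). state_wt N (L # D) (map int s) us) =
      (\<Sum>(u, us)\<in>?W \<times> states {0..int N} D. layer_int N L u (map int s) * state_wt N D u us)"
    unfolding states_Cons by (subst sum.reindex) (auto simp: inj_on_def intro!: sum.cong)
  also have "\<dots> = (\<Sum>u\<in>?W. layer_int N L u (map int s) * (\<Sum>us\<in>states {0..int N} D. state_wt N D u us))"
    by (simp add: sum.cartesian_product[symmetric] sum_distrib_left)
  also have "\<dots> = (\<Sum>u\<in>basis N (length (layer_tgt L)).
      layer_int N L (map int u) (map int s) * (\<Sum>us\<in>states {0..int N} D. state_wt N D (map int u) us))"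
    unfolding W by (subst sum.reindex) (auto simp: inj_on_def inj_map_eq_map)
  also have "\<dots> = (\<Sum>u\<in>basis N (length (layer_tgt L)). layer_op N L u s * diagram_op N D [] u)"
    using Cons by (intro sum.cong) (auto simp: layer_op_eq)
  finally show ?case by (simp add: mult.commute)
qed

lemma jones_eq_sum:
  assumes "composable [] D []"
  shows "jones N D = (\<Sum>us\<in>states {0..int N} D. state_wt N D [] us)"
  using diagram_op_eq_sum[OF assms, of "[]" N] by (simp add: jones_def basis_def)

lemma state_wt_prod:
  assumes "length us = length D"
  shows "state_wt N D s us = (\<Prod>k<length D. layer_int N (D ! k) (us ! k) ((s # us) ! k))"
  using assms
proof (induction D arbitrary: s us)
  case (Cons L D)
  then obtain u us' where us: "us = u # us'" "length us' = length D" by (cases us) auto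
  show ?case using Cons.IH[OF us(2), of u]
    by (simp add: us(1) prod.lessThan_Suc_shift del: prod.lessThan_Suc)
qed simp

section \<open>Propagation of labels\<close>

lemma R_int_nonzero:
  assumes "R_int N i j a b \<noteq> 0"
  obtains k where "a = i + int k" "j = b + int k" "crossing_term N i b k \<noteq> 0" "fps_X ^ k dvd R_int N i j a b"
proof -
  have c: "i \<le> a" "a - i = j - b" using assms by (auto simp: R_int_def split: if_splits)
  show ?thesis
  proof (rule that)
    show "a = i + int (nat (a - i))" "j = b + int (nat (a - i))" using c by auto
    show "crossing_term N i b (nat (a - i)) \<noteq> 0" using assms c by (auto simp: R_int_def Let_def)
    show "fps_X ^ nat (a - i) dvd R_int N i j a b"
      using c by (auto simp: R_int_def Let_def intro!: dvd_mult X_power_dvd_crossing_term)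
  qed
qed

lemma Rinv_int_nonzero:
  assumes "Rinv_int N i j a b \<noteq> 0"
  obtains k where "a = i + int k" "j = b + int k" "crossing_term N i b k \<noteq> 0" "fps_X ^ k dvd Rinv_int N i j a b"
proof -
  have c: "i \<le> a" "a - i = j - b" using assms by (auto simp: Rinv_int_def split: if_splits)
  show ?thesis
  proof (rule that)
    show "a = i + int (nat (a - i))" "j = b + int (nat (a - i))" using c by auto
    show "crossing_term N i b (nat (a - i)) \<noteq> 0" using assms c by (auto simp: Rinv_int_def Let_def)
    show "fps_X ^ nat (a - i) dvd Rinv_int N i j a b"
      using c by (auto simp: Rinv_int_def Let_def intro!: dvd_mult X_power_dvd_crossing_term)
  qed
qed

text \<open>
  The number of strands through a horizontal line whose label satisfies \<open>Q\<close>, upward strands counted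
  positively and downward strands negatively.
\<close>

definition flux :: "(int \<Rightarrow> bool) \<Rightarrow> orient list \<Rightarrow> int list \<Rightarrow> int" where
  "flux Q os s = (\<Sum>(o1, x)\<leftarrow>zip os s. if Q x then (if o1 = Up then 1 else - 1) else 0)"

lemma flux_Nil [simp]: "flux Q [] s = 0" "flux Q os [] = 0"
  by (simp_all add: flux_def)

lemma flux_Cons [simp]:
  "flux Q (o1 # os) (x # s) = (if Q x then (if o1 = Up then 1 else - 1) else 0) + flux Q os s"
  by (simp add: flux_def)

lemma flux_append:
  "length os = length s \<Longrightarrow> flux Q (os @ os') (s @ s') = flux Q os s + flux Q os' s'"
  by (simp add: flux_def)

text \<open>
  \<open>Q\<close> is one of the two ways in which a label leaves \<open>[0, N]\<close>: above \<open>N\<close> or below \<open>0\<close>.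
\<close>

definition escape :: "nat \<Rightarrow> (int \<Rightarrow> bool) \<Rightarrow> bool" where
  "escape N Q \<longleftrightarrow> Q = (\<lambda>x. int N < x) \<or> Q = (\<lambda>x. x < 0)"

lemma escape_crossing_term:
  assumes "escape N Q" "crossing_term N i b k \<noteq> 0"
  shows "Q (i + int k) \<Longrightarrow> Q i" "Q b \<Longrightarrow> Q (b + int k)"
  using assms crossing_term_source_gt[OF assms(2)] crossing_term_target_neg[OF assms(2)] by (auto simp: escape_def)

text \<open>
  Along an upward strand through a crossing of nonzero weight, an escaped label stays escaped, so the
  flux cannot decrease; if it is constant, no label escapes or returns.
\<close>

lemma elem_int_flux:
  assumes "escape N Q" "elem_int N e t s \<noteq> 0" "length s = length (elem_src e)" "length t = length (elem_tgt e)"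
  shows "flux Q (elem_src e) s \<le> flux Q (elem_tgt e) t"
    and "flux Q (elem_src e) s = flux Q (elem_tgt e) t \<Longrightarrow>
      (\<And>j. j < length s \<Longrightarrow> lab (k, i + j) = s ! j) \<Longrightarrow>
      (\<And>j. j < length t \<Longrightarrow> lab (Suc k, i + j) = t ! j) \<Longrightarrow>
      (p, q) \<in> elem_arcs k i e \<Longrightarrow> Q (lab p) \<longleftrightarrow> Q (lab q)"
proof -
  have "flux Q (elem_src e) s \<le> flux Q (elem_tgt e) t \<and>
     (flux Q (elem_src e) s = flux Q (elem_tgt e) t \<longrightarrow>
      (\<forall>j<length s. lab (k, i + j) = s ! j) \<longrightarrow>
      (\<forall>j<length t. lab (Suc k, i + j) = t ! j) \<longrightarrow>
      (p, q) \<in> elem_arcs k i e \<longrightarrow> Q (lab p) \<longleftrightarrow> Q (lab q))"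
  proof (cases e)
    case Pos
    then obtain x y x' y' where st: "s = [x, y]" "t = [x', y']"
      using assms(3,4) by (auto simp: length_2_cases)
    from assms(2) have "R_int N y' x' x y \<noteq> 0" by (simp add: Pos st)
    then obtain m where "x = y' + int m" "x' = y + int m" "crossing_term N y' y m \<noteq> 0"
      by (rule R_int_nonzero)
    then have "Q x \<longrightarrow> Q y'" "Q y \<longrightarrow> Q x'" using escape_crossing_term[OF assms(1)] by auto
    then show ?thesis by (auto simp: Pos st all_less_two)
  next
    case Neg
    then obtain x y x' y' where st: "s = [x, y]" "t = [x', y']"
      using assms(3,4) by (auto simp: length_2_cases)
    from assms(2) have "Rinv_int N x' y' y x \<noteq> 0" by (simp add: Neg st)
    then obtain m where "y = x' + int m" "y' = x + int m" "crossing_term N x' x m \<noteq> 0"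
      by (rule Rinv_int_nonzero)
    then have "Q x \<longrightarrow> Q y'" "Q y \<longrightarrow> Q x'" using escape_crossing_term[OF assms(1)] by auto
    then show ?thesis by (auto simp: Neg st all_less_two)
  qed (use assms in \<open>auto simp: length_2_cases all_less_two split: if_splits\<close>)
  then show "flux Q (elem_src e) s \<le> flux Q (elem_tgt e) t"
    and "flux Q (elem_src e) s = flux Q (elem_tgt e) t \<Longrightarrow>
      (\<And>j. j < length s \<Longrightarrow> lab (k, i + j) = s ! j) \<Longrightarrow>
      (\<And>j. j < length t \<Longrightarrow> lab (Suc k, i + j) = t ! j) \<Longrightarrow>
      (p, q) \<in> elem_arcs k i e \<Longrightarrow> Q (lab p) \<longleftrightarrow> Q (lab q)"
    by blast+
qed

text \<open>
  A change of label by \<open>m\<close> along a strand costs a factor \<open>h^m\<close>.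
\<close>

lemma elem_int_displacement:
  assumes "elem_int N e t s \<noteq> 0" "length s = length (elem_src e)" "length t = length (elem_tgt e)"
    and lab: "\<And>j. j < length s \<Longrightarrow> lab (k, i + j) = s ! j"
      "\<And>j. j < length t \<Longrightarrow> lab (Suc k, i + j) = t ! j"
    and arc: "(p, q) \<in> elem_arcs k i e"
  shows "fps_X ^ nat \<bar>lab p - lab q\<bar> dvd elem_int N e t s"
proof (cases e)
  case Pos
  then obtain x y x' y' where st: "s = [x, y]" "t = [x', y']"
    using assms(2,3) by (auto simp: length_2_cases)
  from assms(1) have "R_int N y' x' x y \<noteq> 0" by (simp add: Pos st)
  then obtain m where m: "x = y' + int m" "x' = y + int m" "fps_X ^ m dvd R_int N y' x' x y"
    by (rule R_int_nonzero)
  have "lab (k, i) = x" "lab (k, Suc i) = y" "lab (Suc k, i) = x'" "lab (Suc k, Suc i) = y'"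
    using lab(1)[of 0] lab(1)[of 1] lab(2)[of 0] lab(2)[of 1] by (auto simp: st)
  then have "nat \<bar>lab p - lab q\<bar> = m" using arc m(1,2) by (auto simp: Pos)
  then show ?thesis using m(3) by (simp add: Pos st)
next
  case Neg
  then obtain x y x' y' where st: "s = [x, y]" "t = [x', y']"
    using assms(2,3) by (auto simp: length_2_cases)
  from assms(1) have "Rinv_int N x' y' y x \<noteq> 0" by (simp add: Neg st)
  then obtain m where m: "y = x' + int m" "y' = x + int m" "fps_X ^ m dvd Rinv_int N x' y' y x"
    by (rule Rinv_int_nonzero)
  have "lab (k, i) = x" "lab (k, Suc i) = y" "lab (Suc k, i) = x'" "lab (Suc k, Suc i) = y'"
    using lab(1)[of 0] lab(1)[of 1] lab(2)[of 0] lab(2)[of 1] by (auto simp: st)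
  then have "nat \<bar>lab p - lab q\<bar> = m" using arc m(1,2) by (auto simp: Neg)
  then show ?thesis using m(3) by (simp add: Neg st)
qed (use assms lab(1)[of 0] lab(1)[of 1] lab(2)[of 0] lab(2)[of 1] in
    \<open>auto simp: length_2_cases split: if_splits\<close>)

lemma layer_int_nonzero_split:
  assumes "layer_int N (l, e, r) t s \<noteq> 0"
    "length s = length (layer_src (l, e, r))" "length t = length (layer_tgt (l, e, r))"
  obtains s1 s2 s3 t2 where "s = s1 @ s2 @ s3" "t = s1 @ t2 @ s3"
    "length s1 = length l" "length s2 = length (elem_src e)" "length t2 = length (elem_tgt e)"
    "length s3 = length r" "layer_int N (l, e, r) t s = elem_int N e t2 s2"
proof -
  let ?a = "length l" and ?m = "length (elem_src e)" and ?n = "length (elem_tgt e)"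
  have eq: "take ?a t = take ?a s" "drop (?a + ?n) t = drop (?a + ?m) s"
    "layer_int N (l, e, r) t s = elem_int N e (take ?n (drop ?a t)) (take ?m (drop ?a s))"
    using assms(1) by (auto simp: Let_def split: if_splits)
  have split: "xs = take a xs @ take b (drop a xs) @ drop (a + b) xs" for a b and xs :: "int list"
    by (metis add.commute append_take_drop_id drop_drop)
  show ?thesis
    by (rule that[of "take ?a s" "take ?m (drop ?a s)" "drop (?a + ?m) s" "take ?n (drop ?a t)"])
      (use assms(2,3) eq split[of s ?a ?m] split[of t ?a ?n] in auto)
qed

lemma layer_arcs_related:
  assumes s: "s = s1 @ s2 @ s3" and t: "t = s1 @ t2 @ s3"
    and len: "length s1 = length l" "length s2 = length (elem_src e)" "length t2 = length (elem_tgt e)"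
      "length s3 = length r"
    and lab: "\<And>j. j < length s \<Longrightarrow> lab (k, j) = s ! j" "\<And>j. j < length t \<Longrightarrow> lab (Suc k, j) = t ! j"
    and refl: "\<And>x. P x x"
    and elem: "\<And>p q. (\<And>j. j < length s2 \<Longrightarrow> lab (k, length l + j) = s2 ! j) \<Longrightarrow>
        (\<And>j. j < length t2 \<Longrightarrow> lab (Suc k, length l + j) = t2 ! j) \<Longrightarrow>
        (p, q) \<in> elem_arcs k (length l) e \<Longrightarrow> P (lab p) (lab q)"
    and arc: "(p, q) \<in> layer_arcs k (l, e, r)"
  shows "P (lab p) (lab q)"
proof -
  from arc consider (left) i where "i < length l" "p = (k, i)" "q = (k + 1, i)"
    | (elem) "(p, q) \<in> elem_arcs k (length l) e"
    | (right) j where "j < length r" "p = (k, length l + length (elem_src e) + j)"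
        "q = (k + 1, length l + length (elem_tgt e) + j)"
    by auto
  then show ?thesis
  proof cases
    case left
    then have "lab p = lab q"
      using lab(1)[of i] lab(2)[of i] len by (simp add: s t nth_append)
    then show ?thesis using refl by simp
  next
    case elem
    show ?thesis
    proof (rule assms(10)[OF _ _ elem])
      show "lab (k, length l + j) = s2 ! j" if "j < length s2" for j
        using that lab(1)[of "length l + j"] len by (simp add: s nth_append)
      show "lab (Suc k, length l + j) = t2 ! j" if "j < length t2" for j
        using that lab(2)[of "length l + j"] len by (simp add: t nth_append)
    qed
  next
    case right
    then have "lab p = s3 ! j" "lab q = s3 ! j"
      using lab(1)[of "length l + length (elem_src e) + j"] lab(2)[of "length l + length (elem_tgt e) + j"] len
      by (simp_all add: s t nth_append)
    then show ?thesis using refl by simp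
  qed
qed

lemma layer_int_flux:
  assumes Q: "escape N Q" and nz: "layer_int N L t s \<noteq> 0"
    and len: "length s = length (layer_src L)" "length t = length (layer_tgt L)"
  shows "flux Q (layer_src L) s \<le> flux Q (layer_tgt L) t"
proof -
  obtain l e r where L: "L = (l, e, r)" by (cases L)
  from nz len obtain s1 s2 s3 t2 where st: "s = s1 @ s2 @ s3" "t = s1 @ t2 @ s3"
    "length s1 = length l" "length s2 = length (elem_src e)" "length t2 = length (elem_tgt e)"
    "length s3 = length r" "layer_int N (l, e, r) t s = elem_int N e t2 s2"
    unfolding L by (rule layer_int_nonzero_split)
  have "flux Q (elem_src e) s2 \<le> flux Q (elem_tgt e) t2"
    using nz st by (intro elem_int_flux(1)[OF Q]) (auto simp: L)
  then show ?thesis using st by (simp add: L flux_append)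
qed

lemma layer_int_flux_eq:
  assumes Q: "escape N Q" and nz: "layer_int N L t s \<noteq> 0"
    and len: "length s = length (layer_src L)" "length t = length (layer_tgt L)"
    and eq: "flux Q (layer_src L) s = flux Q (layer_tgt L) t"
    and lab: "\<And>j. j < length s \<Longrightarrow> lab (k, j) = s ! j" "\<And>j. j < length t \<Longrightarrow> lab (Suc k, j) = t ! j"
    and arc: "(p, q) \<in> layer_arcs k L"
  shows "Q (lab p) \<longleftrightarrow> Q (lab q)"
proof -
  obtain l e r where L: "L = (l, e, r)" by (cases L)
  from nz len obtain s1 s2 s3 t2 where st: "s = s1 @ s2 @ s3" "t = s1 @ t2 @ s3"
    "length s1 = length l" "length s2 = length (elem_src e)" "length t2 = length (elem_tgt e)"
    "length s3 = length r" "layer_int N (l, e, r) t s = elem_int N e t2 s2"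
    unfolding L by (rule layer_int_nonzero_split)
  have eq': "flux Q (elem_src e) s2 = flux Q (elem_tgt e) t2"
    using eq st by (simp add: L flux_append)
  have nz': "elem_int N e t2 s2 \<noteq> 0" using nz st by (simp add: L)
  show ?thesis
    by (rule layer_arcs_related[where P = "\<lambda>x y. Q x \<longleftrightarrow> Q y", OF st(1-6) _ _ refl _ arc[unfolded L]])
      (erule lab, erule lab, rule elem_int_flux(2)[OF Q nz' st(4,5) eq'])
qed

lemma layer_int_displacement:
  assumes nz: "layer_int N L t s \<noteq> 0"
    and len: "length s = length (layer_src L)" "length t = length (layer_tgt L)"
    and lab: "\<And>j. j < length s \<Longrightarrow> lab (k, j) = s ! j" "\<And>j. j < length t \<Longrightarrow> lab (Suc k, j) = t ! j"
    and arc: "(p, q) \<in> layer_arcs k L"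
  shows "fps_X ^ nat \<bar>lab p - lab q\<bar> dvd layer_int N L t s"
proof -
  obtain l e r where L: "L = (l, e, r)" by (cases L)
  from nz len obtain s1 s2 s3 t2 where st: "s = s1 @ s2 @ s3" "t = s1 @ t2 @ s3"
    "length s1 = length l" "length s2 = length (elem_src e)" "length t2 = length (elem_tgt e)"
    "length s3 = length r" "layer_int N (l, e, r) t s = elem_int N e t2 s2"
    unfolding L by (rule layer_int_nonzero_split)
  have nz': "elem_int N e t2 s2 \<noteq> 0" using nz st by (simp add: L)
  have "fps_X ^ nat \<bar>lab p - lab q\<bar> dvd elem_int N e t2 s2"
    by (rule layer_arcs_related[where P = "\<lambda>x y. fps_X ^ nat \<bar>x - y\<bar> dvd elem_int N e t2 s2",
          OF st(1-6) _ _ _ _ arc[unfolded L]])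
      (erule lab, erule lab, simp, rule elem_int_displacement[OF nz' st(4,5)])
  then show ?thesis using st by (simp add: L)
qed

section \<open>Labels on a knot\<close>

lemma composable_nth:
  assumes "composable o1 D v" "k < length D"
  shows "k = 0 \<Longrightarrow> layer_src (D ! k) = o1"
    and "0 < k \<Longrightarrow> layer_src (D ! k) = layer_tgt (D ! (k - 1))"
    and "Suc k = length D \<Longrightarrow> layer_tgt (D ! k) = v"
proof -
  have "(k = 0 \<longrightarrow> layer_src (D ! k) = o1) \<and>
      (0 < k \<longrightarrow> layer_src (D ! k) = layer_tgt (D ! (k - 1))) \<and>
      (Suc k = length D \<longrightarrow> layer_tgt (D ! k) = v)"
    using assms
  proof (induction D arbitrary: o1 k)
    case (Cons L D)
    show ?case
    proof (cases k)
      case 0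
      then show ?thesis using Cons.prems by auto
    next
      case (Suc j)
      have "composable (layer_tgt L) D v" "j < length D" using Cons.prems Suc by auto
      note IH = Cons.IH[OF this]
      show ?thesis
      proof (intro conjI impI)
        show "layer_src ((L # D) ! k) = layer_tgt ((L # D) ! (k - 1))"
          using IH by (cases j) (simp_all add: Suc)
        assume "Suc k = length (L # D)"
        then have "layer_tgt (D ! j) = v" using IH Suc by (metis length_Cons nat.inject)
        then show "layer_tgt ((L # D) ! k) = v" by (simp add: Suc)
      qed (simp add: Suc)
    qed
  qed simp
  then show "k = 0 \<Longrightarrow> layer_src (D ! k) = o1"
    and "0 < k \<Longrightarrow> layer_src (D ! k) = layer_tgt (D ! (k - 1))"
    and "Suc k = length D \<Longrightarrow> layer_tgt (D ! k) = v"
    by auto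
qed

lemma states_src_length:
  assumes "composable o1 D v" "us \<in> states A D" "length s = length o1" "k < length D"
  shows "length ((s # us) ! k) = length (layer_src (D ! k))"
  using assms composable_nth(1,2)[OF assms(1,4)] by (cases k) (auto simp: states_nth)

text \<open>
  The flux does not decrease with the height, and it is zero on the empty top line. So a nonnegative
  flux at the bottom forces it to be constant.
\<close>

lemma flux_conserved:
  assumes "composable o1 D []" "state_wt N D s us \<noteq> 0" "us \<in> states A D" "length s = length o1"
    and Q: "escape N Q"
  shows "flux Q o1 s \<le> 0 \<and> (0 \<le> flux Q o1 s \<longrightarrow>
    (\<forall>k<length D. flux Q (layer_src (D ! k)) ((s # us) ! k) = flux Q (layer_tgt (D ! k)) (us ! k)))"
  using assms(1-4)
proof (induction D arbitrary: o1 s us)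
  case Nil
  then show ?case by simp
next
  case (Cons L D)
  then obtain u us' where us: "us = u # us'" "us' \<in> states A D" "length u = length (layer_tgt L)"
    by (auto simp: states_Cons)
  have nz: "layer_int N L u s \<noteq> 0" "state_wt N D u us' \<noteq> 0"
    using Cons.prems(2) by (auto simp: us)
  have o1: "o1 = layer_src L" "composable (layer_tgt L) D []" using Cons.prems by auto
  have le: "flux Q o1 s \<le> flux Q (layer_tgt L) u"
    unfolding o1(1) using Cons.prems by (intro layer_int_flux[OF Q nz(1)] us) (simp add: o1)
  note IH = Cons.IH[OF o1(2) nz(2) us(2,3)]
  show ?case
  proof (intro conjI impI allI)
    show "flux Q o1 s \<le> 0" using le IH by linarith
    fix k assume "0 \<le> flux Q o1 s" "k < length (L # D)"
    then show "flux Q (layer_src ((L # D) ! k)) ((s # us) ! k) = flux Q (layer_tgt ((L # D) ! k)) (us ! k)"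
      using le IH by (cases k) (auto simp: us o1)
  qed
qed

text \<open>
  The label of a point of the diagram; the line below the first layer has no points.
\<close>

definition label :: "int list list \<Rightarrow> nat \<times> nat \<Rightarrow> int" where
  "label us = (\<lambda>(k, i). ([] # us) ! k ! i)"

lemma fps_X_power_dvd_nth:
  assumes "fps_X ^ m dvd f" "fps_nth (f :: complex fps) n \<noteq> 0"
  shows "m \<le> n"
proof -
  obtain g where "f = fps_X ^ m * g" using assms(1) by blast
  then show ?thesis using assms(2) by (simp add: fps_X_power_mult_nth split: if_splits)
qed

lemma label_arc:
  assumes knot: "framed_knot D" and us: "us \<in> states A D"
    and nz: "fps_nth (state_wt N D [] us) n \<noteq> 0" and arc: "(p, q) \<in> arcs D"
  shows "escape N Q \<Longrightarrow> Q (label us p) \<longleftrightarrow> Q (label us q)"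
    and "\<bar>label us p - label us q\<bar> \<le> int n"
proof -
  obtain k where k: "k < length D" "(p, q) \<in> layer_arcs k (D ! k)"
    using arc by (auto simp: arcs_def)
  have comp: "composable [] D []" using knot by (simp add: framed_knot_def)
  have us': "length us = length D" "length (us ! k) = length (layer_tgt (D ! k))"
    using us k by (auto simp: states_nth)
  have src: "length (([] # us) ! k) = length (layer_src (D ! k))"
    using states_src_length[OF comp us _ k(1)] by simp
  define W where "W = layer_int N (D ! k) (us ! k) (([] # us) ! k)"
  have "W dvd state_wt N D [] us"
    unfolding W_def state_wt_prod[OF us'(1)] using k(1) by (intro dvd_prodI) auto
  moreover have st: "state_wt N D [] us \<noteq> 0" using nz by auto
  ultimately have W: "W \<noteq> 0" by auto
  have lab: "label us (k, j) = ([] # us) ! k ! j" "label us (Suc k, j) = us ! k ! j" for j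
    by (simp_all add: label_def)
  show "Q (label us p) \<longleftrightarrow> Q (label us q)" if Q: "escape N Q"
  proof (rule layer_int_flux_eq[OF Q W[unfolded W_def] src us'(2) _ lab k(2)])
    show "flux Q (layer_src (D ! k)) (([] # us) ! k) = flux Q (layer_tgt (D ! k)) (us ! k)"
      using flux_conserved[OF comp st us _ Q] k(1) by simp
  qed
  have "fps_X ^ nat \<bar>label us p - label us q\<bar> dvd W"
    unfolding W_def by (rule layer_int_displacement[OF W[unfolded W_def] src us'(2) lab k(2)])
  then have "fps_X ^ nat \<bar>label us p - label us q\<bar> dvd state_wt N D [] us"
    using \<open>W dvd _\<close> by (rule dvd_trans)
  from fps_X_power_dvd_nth[OF this nz] show "\<bar>label us p - label us q\<bar> \<le> int n"
    by linarith
qed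

lemma finite_arcs: "finite (arcs D)"
proof -
  have "finite (layer_arcs k L)" for k L
  proof -
    obtain l e r where L: "L = (l, e, r)" by (cases L)
    have "finite (elem_arcs k i e)" for i by (cases e) auto
    then show ?thesis by (simp add: L)
  qed
  then show ?thesis by (simp add: arcs_def)
qed

text \<open>
  The number of arcs, in both directions. A shortest path between two points is not longer.
\<close>

definition path_bound :: "diagram \<Rightarrow> nat" where
  "path_bound D = card (arcs D \<union> (arcs D)\<inverse>)"

lemma label_points:
  assumes knot: "framed_knot D" and us: "us \<in> states A D"
    and nz: "fps_nth (state_wt N D [] us) n \<noteq> 0"
    and pq: "p \<in> points D" "q \<in> points D"
  shows "escape N Q \<Longrightarrow> Q (label us p) \<longleftrightarrow> Q (label us q)"
    and "\<bar>label us p - label us q\<bar> \<le> int (n * path_bound D)"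
proof -
  let ?R = "arcs D \<union> (arcs D)\<inverse>"
  have path: "(p, q) \<in> ?R\<^sup>*" using knot pq by (auto simp: framed_knot_def)
  note arc = label_arc[OF knot us nz]
  show "Q (label us p) \<longleftrightarrow> Q (label us q)" if Q: "escape N Q"
    using path by (induction rule: rtrancl_induct) (use arc(1)[OF _ Q] in auto)
  have "finite ?R" by (simp add: finite_arcs)
  then obtain m where m: "m \<le> path_bound D" "(p, q) \<in> ?R ^^ m"
    using path unfolding rtrancl_finite_eq_relpow[OF \<open>finite ?R\<close>] path_bound_def by auto
  have "\<bar>label us p - label us q\<bar> \<le> int (n * m)"
    using m(2)
  proof (induction m arbitrary: q)
    case (Suc m)
    then obtain x where x: "(p, x) \<in> ?R ^^ m" "(x, q) \<in> ?R" by auto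
    have "\<bar>label us x - label us q\<bar> \<le> int n" using x(2) arc(2)[of x q] arc(2)[of q x] by auto
    with Suc.IH[OF x(1)] show ?case by simp
  qed simp
  also have "\<dots> \<le> int (n * path_bound D)" using m(1) by (simp only: of_nat_le_iff mult_le_mono2)
  finally show "\<bar>label us p - label us q\<bar> \<le> int (n * path_bound D)" .
qed

lemma knot_base_point:
  assumes "framed_knot D"
  shows "(1, 0) \<in> points D"
proof -
  have comp: "composable [] D []" and ne: "D \<noteq> []" using assms by (auto simp: framed_knot_def)
  obtain L D' where D: "D = L # D'" using ne by (cases D) auto
  obtain l e r where L: "L = (l, e, r)" by (cases L)
  have e: "e = CupUD \<or> e = CupDU" using comp by (cases e) (auto simp: D L)
  then obtain L' D'' where D': "D' = L' # D''" using comp by (cases D') (auto simp: D L)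
  have "layer_src L' = layer_tgt L" using comp by (auto simp: D D')
  then have "layer_src L' \<noteq> []" using e by (auto simp: L)
  then show ?thesis by (auto simp: points_def D D')
qed

text \<open>
  Every label of a state belongs to a point of the diagram, as the topmost line is empty.
\<close>

lemma in_states_of_labels:
  assumes knot: "framed_knot D" and us: "us \<in> states A D"
    and B: "\<And>p. p \<in> points D \<Longrightarrow> label us p \<in> B"
  shows "us \<in> states B D"
  unfolding states_nth
proof (intro conjI allI impI)
  have comp: "composable [] D []" using knot by (auto simp: framed_knot_def)
  show "length us = length D" using us by (simp add: states_nth)
  fix k assume k: "k < length D"
  show len: "length (us ! k) = length (layer_tgt (D ! k))" using us k by (simp add: states_nth)
  show "set (us ! k) \<subseteq> B"
  proof
    fix x assume "x \<in> set (us ! k)"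
    then obtain i where i: "i < length (us ! k)" "x = us ! k ! i" by (metis in_set_conv_nth)
    have "Suc k \<noteq> length D" using composable_nth(3)[OF comp k] len i by auto
    then have "Suc k < length D" using k by simp
    then have "(Suc k, i) \<in> points D"
      using composable_nth(2)[OF comp, of "Suc k"] len i by (simp add: points_def)
    from B[OF this] show "x \<in> B" by (simp add: label_def i)
  qed
qed

section \<open>Polynomial dependence on the spin\<close>

text \<open>
  Adding a constant to all labels.
\<close>

definition shift :: "int \<Rightarrow> int list list \<Rightarrow> int list list" where
  "shift a = map (map (\<lambda>x. x + a))"

lemma shift_states: "us \<in> states A D \<Longrightarrow> shift a us \<in> states ((\<lambda>x. x + a) ` A) D"
  by (auto simp: states_nth shift_def)

lemma shift_shift [simp]: "shift a (shift b us) = shift (b + a) us"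
  by (simp add: shift_def comp_def add.assoc)

lemma shift_0 [simp]: "shift 0 us = us"
  by (simp add: shift_def)

lemma biv_poly_int_weight: "biv_poly 1 (\<lambda>N a. int_weight N (x + int a))"
  using biv_poly_linear[of 1 "- 2" "- 2 * of_int x"] by (simp add: int_weight_def algebra_simps)

lemma biv_poly_int_weight2: "biv_poly 2 (\<lambda>N a. int_weight N (x + int a) * int_weight N (y + int a) / 4)"
  using biv_poly_cmult[OF biv_poly_mult[OF biv_poly_int_weight[of x] biv_poly_int_weight[of y]], of "1/4"]
  by (simp add: numeral_2_eq_2)

lemma biv_poly_int_weight2_neg: "biv_poly 2 (\<lambda>N a. - int_weight N (x + int a) * int_weight N (y + int a) / 4)"
  using biv_poly_cmult[OF biv_poly_mult[OF biv_poly_int_weight[of x] biv_poly_int_weight[of y]], of "- 1/4"]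
  by (simp add: numeral_2_eq_2)

lemma graded_R_int: "graded 0 (\<lambda>N a. R_int N (i + int a) (j + int a) (x + int a) (y + int a))"
proof (cases "i \<le> x \<and> x - i = j - y")
  case True
  have "graded 0 (\<lambda>N a. fps_exp (int_weight N (i + int a) * int_weight N (j + int a) / 4) *
      fps_exp (of_nat (nat (x - i)) * (of_nat (nat (x - i)) - 1) / 4) *
      crossing_term N (i + int a) (y + int a) (nat (x - i)))"
    by (intro graded_mult0 graded_exp biv_poly_int_weight2 biv_poly.const graded_crossing_term)
  moreover have "R_int N (i + int a) (j + int a) (x + int a) (y + int a) = fps_exp (int_weight N (i + int a) * int_weight N (j + int a) / 4) *
      fps_exp (of_nat (nat (x - i)) * (of_nat (nat (x - i)) - 1) / 4) *
      crossing_term N (i + int a) (y + int a) (nat (x - i))" for N a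
  proof -
    have c: "i + int a \<le> x + int a \<and> x + int a - (i + int a) = j + int a - (y + int a)"
      using True by simp
    have "nat (x + int a - (i + int a)) = nat (x - i)" by simp
    then show ?thesis by (simp only: R_int_def if_P[OF c] Let_def)
  qed
  ultimately show ?thesis by simp
next
  case False
  then have "R_int N (i + int a) (j + int a) (x + int a) (y + int a) = 0" for N a
    by (auto simp: R_int_def)
  then show ?thesis by (simp add: graded_const)
qed

lemma graded_Rinv_int: "graded 0 (\<lambda>N a. Rinv_int N (i + int a) (j + int a) (x + int a) (y + int a))"
proof (cases "i \<le> x \<and> x - i = j - y")
  case True
  have "graded 0 (\<lambda>N a. (- 1) ^ nat (x - i) * fps_exp (- int_weight N (x + int a) * int_weight N (y + int a) / 4) *
      fps_exp (- of_nat (nat (x - i)) * (of_nat (nat (x - i)) - 1) / 4) *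
      crossing_term N (i + int a) (y + int a) (nat (x - i)))"
    by (intro graded_mult0 graded_exp biv_poly_int_weight2_neg biv_poly.const graded_crossing_term graded_const)
  moreover have "Rinv_int N (i + int a) (j + int a) (x + int a) (y + int a) = (- 1) ^ nat (x - i) * fps_exp (- int_weight N (x + int a) * int_weight N (y + int a) / 4) *
      fps_exp (- of_nat (nat (x - i)) * (of_nat (nat (x - i)) - 1) / 4) *
      crossing_term N (i + int a) (y + int a) (nat (x - i))" for N a
  proof -
    have c: "i + int a \<le> x + int a \<and> x + int a - (i + int a) = j + int a - (y + int a)"
      using True by simp
    have "nat (x + int a - (i + int a)) = nat (x - i)" by simp
    then show ?thesis by (simp only: Rinv_int_def if_P[OF c] Let_def)
  qed
  ultimately show ?thesis by simp
next
  case False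
  then have "Rinv_int N (i + int a) (j + int a) (x + int a) (y + int a) = 0" for N a
    by (auto simp: Rinv_int_def)
  then show ?thesis by (simp add: graded_const)
qed

lemma graded_if: "graded 0 F \<Longrightarrow> graded 0 (\<lambda>N a. if c then F N a else 0)"
  by (cases c) (simp_all add: graded_const)

lemma graded_elem_int:
  assumes "length s = length (elem_src e)" "length t = length (elem_tgt e)"
  shows "graded 0 (\<lambda>N a. elem_int N e (map (\<lambda>x. x + int a) t) (map (\<lambda>x. x + int a) s))"
proof -
  have exp: "graded 0 (\<lambda>N a. fps_exp (int_weight N (x + int a) / 2))" "graded 0 (\<lambda>N a. fps_exp (- int_weight N (x + int a) / 2))" for x
    using graded_exp[OF biv_poly_mono[OF biv_poly_cmult[OF biv_poly_int_weight[of x], of "1/2"]]]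
      graded_exp[OF biv_poly_mono[OF biv_poly_cmult[OF biv_poly_int_weight[of x], of "- 1/2"]]]
    by simp_all
  show ?thesis
    using assms exp by (cases e) (auto simp: length_2_cases graded_const graded_R_int graded_Rinv_int intro!: graded_if)
qed

lemma graded_layer_int:
  assumes "length s = length (layer_src L)" "length t = length (layer_tgt L)"
  shows "graded 0 (\<lambda>N a. layer_int N L (map (\<lambda>x. x + int a) t) (map (\<lambda>x. x + int a) s))"
proof -
  obtain l e r where L: "L = (l, e, r)" by (cases L)
  have inj: "map (\<lambda>x. x + int a) xs = map (\<lambda>x. x + int a) ys \<longleftrightarrow> xs = ys" for a xs ys
    by (rule inj_map_eq_map) (simp add: inj_def)
  have "graded 0 (\<lambda>N a. elem_int N e (map (\<lambda>x. x + int a) (take (length (elem_tgt e)) (drop (length l) t)))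
      (map (\<lambda>x. x + int a) (take (length (elem_src e)) (drop (length l) s))))"
    using assms by (intro graded_elem_int) (auto simp: L)
  then show ?thesis
    by (auto simp: L Let_def take_map drop_map inj intro!: graded_if)
qed

lemma graded_state_wt:
  assumes "composable o1 D v" "length s = length o1" "us \<in> states A D"
  shows "graded 0 (\<lambda>N a. state_wt N D (map (\<lambda>x. x + int a) s) (shift (int a) us))"
  using assms
proof (induction D arbitrary: o1 s us)
  case Nil
  then show ?case by (simp add: graded_const)
next
  case (Cons L D)
  then obtain u us' where us: "us = u # us'" "us' \<in> states A D" "length u = length (layer_tgt L)"
    by (auto simp: states_Cons)
  have "graded 0 (\<lambda>N a. layer_int N L (map (\<lambda>x. x + int a) u) (map (\<lambda>x. x + int a) s))"
    using Cons.prems us by (intro graded_layer_int) auto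
  moreover have "graded 0 (\<lambda>N a. state_wt N D (map (\<lambda>x. x + int a) u) (shift (int a) us'))"
    using Cons.prems us by (intro Cons.IH) auto
  ultimately show ?case by (simp add: us shift_def graded_mult0)
qed

text \<open>
  The state sum, ordered by the label \<open>a\<close> of the base point \<open>(1, 0)\<close>. The labellings \<open>g\<close> relative to \<open>a\<close>
  range over a set that does not depend on \<open>N\<close> or \<open>a\<close>. The two sums run over different sets of states, but
  the states in only one of them do not contribute at \<open>h^n\<close>.
\<close>

lemma jones_nth_eq_sum:
  fixes n :: nat
  assumes knot: "framed_knot D"
  defines "B \<equiv> int (n * path_bound D)"
  defines "G \<equiv> {g \<in> states {- B..B} D. label g (1, 0) = 0}"
  shows "fps_nth (jones N D) n =
    (\<Sum>a\<le>N. \<Sum>g\<in>G. fps_nth (state_wt N D [] (shift (int a) g)) n)"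
proof -
  let ?c = "\<lambda>us. fps_nth (state_wt N D [] us) n"
  let ?f = "\<lambda>(a, g). shift (int a) g"
  let ?T = "?f ` ({..N} \<times> G)"
  have comp: "composable [] D []" using knot by (simp add: framed_knot_def)
  have base: "(1, 0) \<in> points D" by (rule knot_base_point[OF knot])
  have label_shift: "label (shift a us) p = label us p + a" if us: "us \<in> states A D" and pt: "p \<in> points D" for a us A p
  proof -
    obtain k i where p: "p = (k, i)" "k < length D" "i < length (layer_src (D ! k))"
      using pt by (auto simp: points_def)
    have k: "k \<noteq> 0" using composable_nth(1)[OF comp, of k] p by (cases k) auto
    have "i < length (([] # us) ! k)" using states_src_length[OF comp us _ p(2)] p by simp
    then show ?thesis
      using k p us by (cases k) (auto simp: label_def shift_def states_nth)
  qed
  have finG: "finite G" unfolding G_def by (simp add: finite_states)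
  have inj: "inj_on ?f ({..N} \<times> G)"
  proof (rule inj_onI, clarify)
    fix a g a' g' assume g: "g \<in> G" "g' \<in> G" and eq: "shift (int a) g = shift (int a') g'"
    have "label (shift (int a) g) (1, 0) = int a" "label (shift (int a') g') (1, 0) = int a'"
      using g label_shift base by (auto simp: G_def)
    then have "a = a'" using eq by simp
    moreover have "shift (- int a) (shift (int a) g) = shift (- int a) (shift (int a') g')"
      using eq by simp
    ultimately show "a = a' \<and> g = g'" by simp
  qed
  have "fps_nth (jones N D) n = (\<Sum>us\<in>states {0..int N} D. ?c us)"
    unfolding jones_eq_sum[OF comp] by (simp add: fps_sum_nth)
  also have "\<dots> = (\<Sum>us\<in>?T. ?c us)"
  proof (rule sum.mono_neutral_cong)
    show "?c us = 0" if "us \<in> states {0..int N} D - ?T" for us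
    proof (rule ccontr)
      assume nz: "?c us \<noteq> 0"
      have us: "us \<in> states {0..int N} D" using that by simp
      \<comment> \<open>The relative labels are bounded, hence \<open>us\<close> occurs on the right hand side.\<close>
      define a where "a = label us (1, 0)"
      have D1: "1 < length D" "layer_src (D ! 1) \<noteq> []" using base by (auto simp: points_def)
      then have "0 < length D" by linarith
      then have us0: "length (us ! 0) = length (layer_tgt (D ! 0))" "set (us ! 0) \<subseteq> {0..int N}"
        using us unfolding states_nth by blast+
      then have "0 < length (us ! 0)" using D1 composable_nth(2)[OF comp, of 1] by simp
      then have "a \<in> set (us ! 0)" by (simp add: a_def label_def)
      then have a: "0 \<le> a" "a \<le> int N" using us0(2) by auto
      have shifted: "shift (- a) us \<in> states UNIV D"
        using shift_states[OF us, of "- a"] by (auto simp: states_nth)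
      have "shift (- a) us \<in> states {- B..B} D"
      proof (rule in_states_of_labels[OF knot shifted])
        fix p assume p: "p \<in> points D"
        show "label (shift (- a) us) p \<in> {- B..B}"
          using label_points(2)[OF knot us nz p base] label_shift[OF us p, of "- a"]
          by (auto simp: B_def a_def)
      qed
      then have "shift (- a) us \<in> G"
        using label_shift[OF us base, of "- a"] by (simp add: G_def a_def)
      moreover have "us = ?f (nat a, shift (- a) us)" using a by simp
      ultimately have "us \<in> ?T" using a by (intro image_eqI[of _ _ "(nat a, shift (- a) us)"]) auto
      then show False using that by simp
    qed
    show "?c us = 0" if "us \<in> ?T - states {0..int N} D" for us
    proof (rule ccontr)
      assume nz: "?c us \<noteq> 0"
      from that obtain a g where ag: "us = shift (int a) g" "a \<le> N" "g \<in> G" by auto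
      have us: "us \<in> states UNIV D"
        using shift_states[of g _ D "int a"] ag by (auto simp: G_def states_nth)
      have lab: "label us (1, 0) = int a"
        using ag label_shift base by (auto simp: G_def)
      \<comment> \<open>The label of the base point is in range, so no label has escaped.\<close>
      have "us \<in> states {0..int N} D"
      proof (rule in_states_of_labels[OF knot us])
        fix p assume p: "p \<in> points D"
        have "\<not> int N < label us p" "\<not> label us p < 0"
          using label_points(1)[OF knot us nz p base, of "\<lambda>x. int N < x"]
            label_points(1)[OF knot us nz p base, of "\<lambda>x. x < 0"] lab ag
          by (auto simp: escape_def)
        then show "label us p \<in> {0..int N}" by simp
      qed
      then show False using that by simp
    qed
  qed (simp_all add: finite_states finG)
  also have "\<dots> = (\<Sum>(a, g)\<in>{..N} \<times> G. ?c (shift (int a) g))"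
    by (subst sum.reindex[OF inj]) (simp add: case_prod_unfold)
  also have "\<dots> = (\<Sum>a\<le>N. \<Sum>g\<in>G. ?c (shift (int a) g))"
    by (simp add: sum.cartesian_product)
  finally show ?thesis .
qed

lemma melvin_morton_expansion:
  assumes knot: "framed_knot D"
  shows "\<exists>!p. degree p \<le> 2 * n \<and>
    (\<forall>N. poly p (of_nat N / 2) = fps_nth (jones N D) n / of_nat (N + 1))"
proof -
  define B where "B = int (n * path_bound D)"
  define G where "G = {g \<in> states {- B..B} D. label g (1, 0) = 0}"
  have comp: "composable [] D []" using knot by (simp add: framed_knot_def)
  have "biv_poly (2 * n) (\<lambda>N a. \<Sum>g\<in>G. fps_nth (state_wt N D [] (shift (int a) g)) n)"
  proof (rule biv_poly_sum)
    fix g assume "g \<in> G"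
    then have "graded 0 (\<lambda>N a. state_wt N D (map (\<lambda>x. x + int a) []) (shift (int a) g))"
      by (intro graded_state_wt[OF comp]) (auto simp: G_def)
    then show "biv_poly (2 * n) (\<lambda>N a. fps_nth (state_wt N D [] (shift (int a) g)) n)"
      by (simp add: graded_def)
  qed
  then obtain p where p: "degree p \<le> 2 * n"
    "\<And>N. (\<Sum>a\<le>N. \<Sum>g\<in>G. fps_nth (state_wt N D [] (shift (int a) g)) n) = of_nat (N + 1) * poly p (of_nat N)"
    by (rule sum_biv_poly) blast
  define q where "q = pcompose p [:0, 2:]"
  have q: "degree q \<le> 2 * n" "poly q (of_nat N / 2) = fps_nth (jones N D) n / of_nat (N + 1)" for N
  proof -
    show "degree q \<le> 2 * n" using p(1) degree_pcompose_le[of p "[:0, 2:]"] by (simp add: q_def)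
    have "fps_nth (jones N D) n = of_nat (N + 1) * poly p (of_nat N)"
      using jones_nth_eq_sum[OF knot, of N n] p(2)[of N] by (simp only: B_def G_def)
    moreover have "(of_nat (N + 1) :: complex) \<noteq> 0" by (simp only: of_nat_eq_0_iff)
    moreover have "poly q (of_nat N / 2) = poly p (of_nat N)"
      by (simp add: q_def poly_pcompose)
    ultimately show "poly q (of_nat N / 2) = fps_nth (jones N D) n / of_nat (N + 1)"
      by (metis nonzero_mult_div_cancel_left)
  qed
  show ?thesis
  proof (rule ex1I[of _ q])
    show "degree q \<le> 2 * n \<and> (\<forall>N. poly q (of_nat N / 2) = fps_nth (jones N D) n / of_nat (N + 1))"
      using q by blast
    fix q' assume q': "degree q' \<le> 2 * n \<and> (\<forall>N. poly q' (of_nat N / 2) = fps_nth (jones N D) n / of_nat (N + 1))"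
    have "range (\<lambda>N. of_nat N / 2) \<subseteq> {x. poly (q' - q) x = 0}"
      using q q' by auto
    moreover have "infinite (range (\<lambda>N. of_nat N / 2 :: complex))"
      by (rule range_inj_infinite) (simp add: inj_def)
    ultimately have "infinite {x. poly (q' - q) x = 0}" using finite_subset by blast
    then have "q' - q = 0" using poly_roots_finite by blast
    then show "q' = q" by simp
  qed
qed

section \<open>Growth of the coefficients at bounded spin\<close>

text \<open>
  Two exponential factors, at most \<open>exp n\<close> each, and the bound of \<open>tnorm_crossing_term\<close>.
\<close>

definition entry_const :: real where
  "entry_const = exp 2 * exp (2 * exp 3)"

text \<open>
  The coefficient of \<open>h^n\<close> is estimated for \<open>N \<le> 2 n\<close> with a radius \<open>r\<close> of order \<open>1 / n\<close>. Labels and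
  weights are of size \<open>n\<close>, so \<open>exp(c h)\<close> with \<open>c\<close> of size \<open>n^2\<close> has norm at most exponential in \<open>n\<close>.
\<close>

context
  fixes n N :: nat and r :: real
  assumes n: "1 \<le> n" and N: "N \<le> 2 * n" and r: "r = 1 / (4 * real n)"
begin

lemma r_nonneg: "0 \<le> r"
  by (simp add: r)

lemma tnorm_exp_square:
  assumes "norm c \<le> (real n)\<^sup>2"
  shows "tnorm n r (fps_exp c) \<le> exp 1 ^ n"
proof -
  have "tnorm n r (fps_exp c) \<le> exp ((real n)\<^sup>2 * r)"
    by (rule tnorm_exp[OF r_nonneg assms])
  also have "(real n)\<^sup>2 * r = real n / 4"
    using n by (simp add: r power2_eq_square)
  also have "exp (real n / 4) \<le> exp (real n * 1)" by simp
  also have "\<dots> = exp 1 ^ n" by (rule exp_of_nat_mult)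
  finally show ?thesis .
qed

lemma norm_int_weight:
  assumes "x \<in> {0..int N}"
  shows "norm (int_weight N x) \<le> 2 * real n"
proof -
  have "int_weight N x = of_int (int N - 2 * x)" by (simp add: int_weight_def)
  then have "norm (int_weight N x) = \<bar>real_of_int (int N - 2 * x)\<bar>" by (simp only: norm_of_int)
  also have "\<dots> = real_of_int \<bar>int N - 2 * x\<bar>" by simp
  also have "\<bar>int N - 2 * x\<bar> \<le> 2 * int n" using assms N by auto
  then have "real_of_int \<bar>int N - 2 * x\<bar> \<le> 2 * real n" by linarith
  finally show ?thesis .
qed

lemma norm_int_weight_mult:
  assumes "x \<in> {0..int N}" "y \<in> {0..int N}"
  shows "norm (int_weight N x * int_weight N y / 4) \<le> (real n)\<^sup>2"
proof -
  have "norm (int_weight N x) * norm (int_weight N y) \<le> (2 * real n) * (2 * real n)"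
    by (intro mult_mono norm_int_weight assms) auto
  then show ?thesis by (simp add: norm_mult norm_divide power2_eq_square)
qed

lemma norm_quarter:
  assumes "k \<le> 2 * n"
  shows "norm (of_nat k * (of_nat k - 1) / 4 :: complex) \<le> (real n)\<^sup>2"
proof -
  have "of_nat k - 1 = (of_real (real k - 1) :: complex)" by simp
  then have "norm (of_nat k - 1 :: complex) = \<bar>real k - 1\<bar>"
    by (metis norm_of_real real_norm_def)
  also have "\<dots> \<le> 2 * real n" using assms n by linarith
  finally have "norm (of_nat k :: complex) * norm (of_nat k - 1 :: complex) \<le> (2 * real n) * (2 * real n)"
    using assms by (intro mult_mono) auto
  then show ?thesis by (simp add: norm_mult norm_divide power2_eq_square)
qed

lemma entry_const_power: "exp 1 ^ n * exp 1 ^ n * exp (2 * exp 3) ^ n = entry_const ^ n"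
proof -
  have "exp 1 * exp 1 = exp (2 :: real)" by (simp flip: exp_add)
  then show ?thesis by (simp only: entry_const_def power_mult_distrib[symmetric])
qed

lemma entry_const_ge: "1 \<le> entry_const ^ n" "exp 1 ^ n \<le> entry_const ^ n"
proof -
  have "exp 1 \<le> entry_const"
    unfolding entry_const_def exp_add[symmetric] exp_le_cancel_iff by (simp add: add_increasing2)
  moreover have "1 \<le> exp (1 :: real)" by simp
  ultimately have "1 \<le> entry_const" by linarith
  with \<open>exp 1 \<le> entry_const\<close> show "1 \<le> entry_const ^ n" "exp 1 ^ n \<le> entry_const ^ n"
    by (simp_all add: power_mono one_le_power)
qed

lemma tnorm_R_int:
  assumes "i \<in> {0..int N}" "j \<in> {0..int N}" "a \<in> {0..int N}" "b \<in> {0..int N}"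
  shows "tnorm n r (R_int N i j a b) \<le> entry_const ^ n"
proof (cases "i \<le> a \<and> a - i = j - b")
  case True
  define k where "k = nat (a - i)"
  have k: "k \<le> 2 * n" "i + int k \<le> int N" "b + int k \<le> int N" using assms True N by (auto simp: k_def)
  have "tnorm n r (fps_exp (int_weight N i * int_weight N j / 4) * fps_exp (of_nat k * (of_nat k - 1) / 4) * crossing_term N i b k)
      \<le> exp 1 ^ n * exp 1 ^ n * exp (2 * exp 3) ^ n"
    using assms k
    by (intro tnorm_mult_le r_nonneg tnorm_exp_square norm_int_weight_mult norm_quarter tnorm_crossing_term n N r) auto
  then show ?thesis
    by (simp only: entry_const_power R_int_def if_P[OF True] Let_def k_def)
next
  case False
  then have "R_int N i j a b = 0" by (auto simp: R_int_def)
  then show ?thesis using entry_const_ge by simp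
qed

lemma tnorm_Rinv_int:
  assumes "i \<in> {0..int N}" "j \<in> {0..int N}" "a \<in> {0..int N}" "b \<in> {0..int N}"
  shows "tnorm n r (Rinv_int N i j a b) \<le> entry_const ^ n"
proof (cases "i \<le> a \<and> a - i = j - b")
  case True
  define k where "k = nat (a - i)"
  have k: "k \<le> 2 * n" "i + int k \<le> int N" "b + int k \<le> int N" using assms True N by (auto simp: k_def)
  have sgn: "tnorm n r ((- 1) ^ k) \<le> 1"
    using tnorm_power_le[OF r_nonneg, of n "- 1" 1 k] by simp
  have w: "norm (- int_weight N a * int_weight N b / 4) \<le> (real n)\<^sup>2" using norm_int_weight_mult[OF assms(3,4)] by simp
  have q: "norm (- of_nat k * (of_nat k - 1) / 4 :: complex) \<le> (real n)\<^sup>2"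
    using norm_quarter[OF k(1)] by (simp add: norm_mult norm_divide)
  have "tnorm n r ((- 1) ^ k * fps_exp (- int_weight N a * int_weight N b / 4) *
      fps_exp (- of_nat k * (of_nat k - 1) / 4) * crossing_term N i b k)
      \<le> 1 * exp 1 ^ n * exp 1 ^ n * exp (2 * exp 3) ^ n"
    using assms k
    by (intro tnorm_mult_le r_nonneg sgn tnorm_exp_square w q tnorm_crossing_term n N r) auto
  then show ?thesis
    by (simp only: mult_1 entry_const_power Rinv_int_def if_P[OF True] Let_def k_def)
next
  case False
  then have "Rinv_int N i j a b = 0" by (auto simp: Rinv_int_def)
  then show ?thesis using entry_const_ge by simp
qed

lemma tnorm_elem_int:
  assumes "length s = length (elem_src e)" "length t = length (elem_tgt e)"
    and "set s \<subseteq> {0..int N}" "set t \<subseteq> {0..int N}"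
  shows "tnorm n r (elem_int N e t s) \<le> entry_const ^ n"
proof -
  have "tnorm n r (fps_exp (int_weight N x / 2)) \<le> entry_const ^ n"
    "tnorm n r (fps_exp (- int_weight N x / 2)) \<le> entry_const ^ n" if "x \<in> {0..int N}" for x
  proof -
    have "norm (int_weight N x / 2) \<le> real n" using norm_int_weight[OF that] by (simp add: norm_divide)
    also have "real n \<le> (real n)\<^sup>2" using n by (simp add: power2_eq_square)
    finally have "norm (int_weight N x / 2) \<le> (real n)\<^sup>2" "norm (- int_weight N x / 2) \<le> (real n)\<^sup>2" by simp_all
    then show "tnorm n r (fps_exp (int_weight N x / 2)) \<le> entry_const ^ n"
      "tnorm n r (fps_exp (- int_weight N x / 2)) \<le> entry_const ^ n"
      using tnorm_exp_square entry_const_ge(2) order_trans by blast+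
  qed
  moreover have "0 \<le> entry_const ^ n" using entry_const_ge(1) by linarith
  ultimately show ?thesis
    using assms entry_const_ge(1)
    by (cases e) (auto simp: length_2_cases intro: tnorm_R_int tnorm_Rinv_int)
qed

lemma tnorm_layer_int:
  assumes "length s = length (layer_src L)" "length t = length (layer_tgt L)"
    and "set s \<subseteq> {0..int N}" "set t \<subseteq> {0..int N}"
  shows "tnorm n r (layer_int N L t s) \<le> entry_const ^ n"
proof -
  obtain l e r' where L: "L = (l, e, r')" by (cases L)
  have "tnorm n r (elem_int N e (take (length (elem_tgt e)) (drop (length l) t))
      (take (length (elem_src e)) (drop (length l) s))) \<le> entry_const ^ n"
    using assms by (intro tnorm_elem_int) (auto simp: L dest!: in_set_takeD in_set_dropD)
  moreover have "0 \<le> entry_const ^ n" using entry_const_ge(1) by linarith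
  ultimately show ?thesis by (simp add: L Let_def)
qed

lemma tnorm_state_wt:
  assumes "composable o1 D v" "length s = length o1" "us \<in> states {0..int N} D" "set s \<subseteq> {0..int N}"
  shows "tnorm n r (state_wt N D s us) \<le> (entry_const ^ n) ^ length D"
  using assms
proof (induction D arbitrary: o1 s us)
  case Nil
  then show ?case by simp
next
  case (Cons L D)
  then obtain u us' where us: "us = u # us'" "us' \<in> states {0..int N} D"
    "length u = length (layer_tgt L)" "set u \<subseteq> {0..int N}"
    by (auto simp: states_Cons)
  have "tnorm n r (layer_int N L u s * state_wt N D u us') \<le> entry_const ^ n * (entry_const ^ n) ^ length D"
    using Cons.prems us by (intro tnorm_mult_le r_nonneg tnorm_layer_int Cons.IH) auto
  then show ?case by (simp add: us(1))
qed

end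

text \<open>
  In the \<open>n\<close>-th power, the first factor bounds the number of states for \<open>N \<le> 2 n\<close>, the second one the
  product over the layers, and the last one compares \<open>(4 n)^n\<close> with \<open>n!\<close>.
\<close>

definition jones_const :: "diagram \<Rightarrow> real" where
  "jones_const D = 3 ^ (\<Sum>L\<leftarrow>D. length (layer_tgt L)) * entry_const ^ length D * (4 * exp 1)"

lemma jones_const_pos: "0 < jones_const D"
  by (simp add: jones_const_def entry_const_def)

lemma le_3_power: "2 * n + 1 \<le> (3 :: nat) ^ n"
  by (induction n) auto

lemma jones_nth_bound:
  assumes comp: "composable [] D []" and n: "1 \<le> n" and N: "N \<le> 2 * n"
  shows "norm (fps_nth (jones N D) n) \<le> jones_const D ^ n * fact n"
proof -
  define r where "r = 1 / (4 * real n)"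
  define W where "W = (\<Sum>L\<leftarrow>D. length (layer_tgt L))"
  have r0: "0 < r" using n by (simp add: r_def)
  have "tnorm n r (jones N D) \<le> (\<Sum>us\<in>states {0..int N} D. tnorm n r (state_wt N D [] us))"
    unfolding jones_eq_sum[OF comp] using r0 by (intro tnorm_sum) simp
  also have "\<dots> \<le> (\<Sum>us\<in>states {0..int N} D. (entry_const ^ n) ^ length D)"
    by (intro sum_mono tnorm_state_wt[OF n N r_def comp]) auto
  also have "\<dots> = real ((N + 1) ^ W) * (entry_const ^ n) ^ length D"
    by (simp add: card_states W_def nat_add_distrib)
  also have "\<dots> \<le> (3 ^ n) ^ W * (entry_const ^ n) ^ length D"
  proof (intro mult_right_mono)
    have "N + 1 \<le> 3 ^ n" using N le_3_power[of n] by linarith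
    then have "(N + 1) ^ W \<le> (3 ^ n) ^ W" by (intro power_mono) auto
    then have "real ((N + 1) ^ W) \<le> real ((3 ^ n) ^ W)" by (simp only: of_nat_le_iff)
    then show "real ((N + 1) ^ W) \<le> (3 ^ n) ^ W" by simp
  qed (simp add: entry_const_def)
  finally have T: "tnorm n r (jones N D) \<le> (3 ^ W * entry_const ^ length D) ^ n"
    by (simp add: power_mult_distrib flip: power_mult) (simp add: mult.commute)
  have "real n ^ n \<le> exp 1 ^ n * fact n"
    using exp_ge_power_div_fact[of "real n" n] exp_of_nat_mult[of n "1 :: real"]
    by (simp add: divide_simps)
  then have F: "1 / r ^ n \<le> (4 * exp 1) ^ n * fact n"
    by (simp add: r_def power_divide power_mult_distrib)
  have "norm (fps_nth (jones N D) n) \<le> tnorm n r (jones N D) / r ^ n"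
    by (rule norm_nth_le_tnorm[OF r0])
  also have "\<dots> = tnorm n r (jones N D) * (1 / r ^ n)" by simp
  also have "\<dots> \<le> (3 ^ W * entry_const ^ length D) ^ n * ((4 * exp 1) ^ n * fact n)"
    using T F r0 by (intro mult_mono) (auto simp: entry_const_def)
  also have "\<dots> = jones_const D ^ n * fact n"
    by (simp add: jones_const_def W_def power_mult_distrib)
  finally show ?thesis .
qed

section \<open>Newton interpolation\<close>

text \<open>
  The forward difference.
\<close>

definition fdiff :: "(nat \<Rightarrow> complex) \<Rightarrow> nat \<Rightarrow> complex" where
  "fdiff f i = f (Suc i) - f i"

lemma newton_forward:
  assumes "i \<le> m"
  shows "f i = (\<Sum>k\<le>m. of_nat (i choose k) * (fdiff ^^ k) f 0)"
  using assms
proof (induction i arbitrary: f m)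
  case 0
  have "(\<Sum>k\<le>m. of_nat (0 choose k) * (fdiff ^^ k) f 0) = (\<Sum>k\<le>m. if k = 0 then f 0 else 0)"
    by (rule sum.cong) auto
  then show ?case by simp
next
  case (Suc i)
  then obtain m' where m: "m = Suc m'" "i \<le> m'" by (cases m) auto
  have "f (Suc i) = f i + fdiff f i" by (simp add: fdiff_def)
  also have "f i = f 0 + (\<Sum>k\<le>m'. of_nat (i choose Suc k) * (fdiff ^^ Suc k) f 0)"
    using Suc.IH[of m f] m(2) unfolding m(1) sum.atMost_Suc_shift
    by (simp del: funpow.simps sum.atMost_Suc)
  also have "fdiff f i = (\<Sum>k\<le>m'. of_nat (i choose k) * (fdiff ^^ Suc k) f 0)"
    using Suc.IH[of m' "fdiff f"] m by (simp add: funpow_Suc_right del: funpow.simps)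
  also have "f 0 + (\<Sum>k\<le>m'. of_nat (i choose Suc k) * (fdiff ^^ Suc k) f 0) +
      (\<Sum>k\<le>m'. of_nat (i choose k) * (fdiff ^^ Suc k) f 0) =
      (\<Sum>k\<le>m. of_nat (Suc i choose k) * (fdiff ^^ k) f 0)"
    unfolding m sum.atMost_Suc_shift[of _ m']
    by (simp add: sum.distrib algebra_simps del: funpow.simps)
  finally show ?case .
qed

lemma fdiff_bound:
  assumes "\<And>i. i \<le> m \<Longrightarrow> norm (f i) \<le> M" "i + k \<le> m"
  shows "norm ((fdiff ^^ k) f i) \<le> 2 ^ k * M"
  using assms(2)
proof (induction k arbitrary: i)
  case 0
  then show ?case using assms(1) by simp
next
  case (Suc k)
  have "norm ((fdiff ^^ Suc k) f i) \<le> norm ((fdiff ^^ k) f (Suc i)) + norm ((fdiff ^^ k) f i)"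
    by (simp add: fdiff_def norm_triangle_ineq4)
  also have "\<dots> \<le> 2 ^ k * M + 2 ^ k * M"
    using Suc by (intro add_mono) auto
  finally show ?case by (simp add: mult_ac)
qed

lemma norm_gbinomial_le: "norm (x gchoose k :: complex) \<le> (norm x + 1) ^ k"
proof (induction k)
  case 0
  then show ?case by simp
next
  case (Suc k)
  have "real (Suc k) * norm (x gchoose Suc k) = norm (x - of_nat k) * norm (x gchoose k)"
    using gbinomial_Suc_mult by (metis norm_mult norm_of_nat)
  also have "\<dots> \<le> (norm x + real k) * (norm x + 1) ^ k"
    using norm_triangle_ineq4[of x "of_nat k"] by (intro mult_mono Suc) auto
  also have "\<dots> \<le> (real (Suc k) * (norm x + 1)) * (norm x + 1) ^ k"
    by (intro mult_right_mono) (auto simp: algebra_simps)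
  also have "\<dots> = real (Suc k) * (norm x + 1) ^ Suc k"
    by (simp only: power_Suc mult.assoc)
  finally show ?case
    by (rule mult_left_le_imp_le) simp
qed

text \<open>
  The Newton series with nodes \<open>0, ..., m\<close>: the \<open>k\<close>-th difference is at most \<open>2^k M\<close>, and the binomial
  coefficient at \<open>x\<close> is at most \<open>(|x| + 1)^k\<close>.
\<close>

lemma poly_norm_interpolation:
  fixes p :: "complex poly"
  assumes deg: "degree p \<le> m" and M: "\<And>i. i \<le> m \<Longrightarrow> norm (poly p (of_nat i)) \<le> M"
  shows "norm (poly p x) \<le> M * (real m + 1) * (2 * (norm x + 1)) ^ m"
proof -
  define f where "f i = poly p (of_nat i)" for i
  have "\<exists>b. \<forall>k. degree (b k :: complex poly) \<le> k \<and> (\<forall>x. poly (b k) x = x gchoose k)"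
    using binomial_polynomial by metis
  then obtain b :: "nat \<Rightarrow> complex poly" where b: "\<And>k. degree (b k) \<le> k" "\<And>k x. poly (b k) x = x gchoose k"
    by blast
  define q where "q = (\<Sum>k\<le>m. Polynomial.smult ((fdiff ^^ k) f 0) (b k))"
  have q: "poly q x = (\<Sum>k\<le>m. (x gchoose k) * (fdiff ^^ k) f 0)" for x
    by (simp add: q_def poly_sum b mult.commute)
  have "degree q \<le> m"
    unfolding q_def using b(1) by (intro degree_sum_le) (auto intro: order_trans[OF degree_smult_le] order_trans)
  moreover have "poly q (of_nat i) = poly p (of_nat i)" if "i \<le> m" for i
    using newton_forward[OF that, of f] by (simp add: q f_def binomial_gbinomial)
  moreover have "card ((of_nat :: nat \<Rightarrow> complex) ` {..m}) = Suc m"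
    by (simp add: card_image)
  ultimately have "p = q"
    using deg by (intro poly_eqI_degree[of "of_nat ` {..m}"]) auto
  then have "norm (poly p x) \<le> (\<Sum>k\<le>m. norm ((x gchoose k) * (fdiff ^^ k) f 0))"
    by (simp add: q norm_sum)
  also have "\<dots> \<le> (\<Sum>k\<le>m. M * (2 * (norm x + 1)) ^ m)"
  proof (rule sum_mono)
    fix k assume k: "k \<in> {..m}"
    have M0: "0 \<le> M" using M[of 0] norm_ge_zero order_trans by blast
    have "norm ((x gchoose k) * (fdiff ^^ k) f 0) \<le> (norm x + 1) ^ k * (2 ^ k * M)"
      unfolding norm_mult using k M
      by (intro mult_mono norm_gbinomial_le fdiff_bound) (auto simp: f_def)
    also have "\<dots> = M * (2 * (norm x + 1)) ^ k" by (simp only: power_mult_distrib mult_ac)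
    also have "\<dots> \<le> M * (2 * (norm x + 1)) ^ m"
      using M0 k by (intro mult_left_mono power_increasing) auto
    finally show "norm ((x gchoose k) * (fdiff ^^ k) f 0) \<le> M * (2 * (norm x + 1)) ^ m" .
  qed
  also have "\<dots> = M * (real m + 1) * (2 * (norm x + 1)) ^ m" by simp
  finally show ?thesis .
qed

section \<open>Gevrey type\<close>

lemma gevrey1_zjones:
  assumes knot: "framed_knot D"
  shows "gevrey1 (zjones D z)"
proof -
  define y where "y = 2 * (norm (2 * z) + 1)"
  define C where "C = jones_const D * 3 * y\<^sup>2"
  have y: "1 \<le> y" by (simp add: y_def)
  have comp: "composable [] D []" using knot by (simp add: framed_knot_def)
  have "norm (fps_nth (zjones D z) n) \<le> C ^ n * fact n" if n: "1 \<le> n" for n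
  proof -
    define q where "q = jones_poly D n"
    define M where "M = jones_const D ^ n * fact n"
    have q: "degree q \<le> 2 * n" "\<And>N. poly q (of_nat N / 2) = fps_nth (jones N D) n / of_nat (N + 1)"
      using theI'[OF melvin_morton_expansion[OF knot, of n]] unfolding q_def jones_poly_def by blast+
    define p where "p = pcompose q [:0, 1/2:]"
    have "degree p \<le> 2 * n"
      using q(1) degree_pcompose_le[of q "[:0, 1/2:]"] by (simp add: p_def)
    moreover have "norm (poly p (of_nat N)) \<le> M" if "N \<le> 2 * n" for N
    proof -
      have "poly p (of_nat N) = fps_nth (jones N D) n / of_nat (N + 1)"
        using q(2)[of N] by (simp add: p_def poly_pcompose)
      then have "norm (poly p (of_nat N)) = norm (fps_nth (jones N D) n) / real (N + 1)"
        by (simp only: norm_divide norm_of_nat)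
      also have "\<dots> \<le> norm (fps_nth (jones N D) n) / 1"
        by (intro divide_left_mono) auto
      also have "\<dots> \<le> M" using jones_nth_bound[OF comp n that] by (simp add: M_def)
      finally show ?thesis .
    qed
    ultimately have "norm (poly p (2 * z)) \<le> M * (real (2 * n) + 1) * y ^ (2 * n)"
      unfolding y_def by (rule poly_norm_interpolation)
    also have "\<dots> \<le> M * 3 ^ n * y ^ (2 * n)"
    proof -
      have "real (2 * n) + 1 = real (2 * n + 1)" by simp
      also have "\<dots> \<le> real (3 ^ n)" using le_3_power[of n] by (simp only: of_nat_le_iff)
      finally have "real (2 * n) + 1 \<le> 3 ^ n" by simp
      then show ?thesis
        using y jones_const_pos[of D] by (intro mult_right_mono mult_left_mono) (auto simp: M_def)
    qed
    also have "\<dots> = C ^ n * fact n"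
      by (simp add: C_def M_def power_mult_distrib power_mult)
    also have "poly p (2 * z) = fps_nth (zjones D z) n"
      by (simp add: p_def poly_pcompose zjones_def q_def)
    finally show ?thesis .
  qed
  moreover have "0 < C" using y jones_const_pos[of D] by (simp add: C_def)
  ultimately show ?thesis unfolding gevrey1_def by blast
qed

text \<open>
  A prefactor extends the bound to the constant coefficient.
\<close>

lemma gevrey1_all:
  assumes "gevrey1 f"
  obtains A C where "0 < C" "0 \<le> A" "\<And>n. norm (fps_nth f n) \<le> A * C ^ n * fact n"
proof -
  obtain C where C: "0 < C" "\<And>n. 1 \<le> n \<Longrightarrow> norm (fps_nth f n) \<le> C ^ n * fact n"
    using assms by (auto simp: gevrey1_def)
  define A where "A = max 1 (norm (fps_nth f 0))"
  have "norm (fps_nth f n) \<le> A * C ^ n * fact n" for n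
  proof (cases "n = 0")
    case False
    then have "norm (fps_nth f n) \<le> 1 * (C ^ n * fact n)" using C(2)[of n] by simp
    also have "\<dots> \<le> A * (C ^ n * fact n)"
      using C(1) by (intro mult_right_mono) (auto simp: A_def)
    finally show ?thesis by (simp add: mult.assoc)
  qed (simp add: A_def)
  then show ?thesis using C(1) by (intro that[of C A]) (auto simp: A_def)
qed

lemma gevrey1_mult:
  assumes "gevrey1 f" "gevrey1 g"
  shows "gevrey1 (f * g)"
proof -
  obtain A C where A: "0 < C" "0 \<le> A" "\<And>n. norm (fps_nth f n) \<le> A * C ^ n * fact n"
    using gevrey1_all[OF assms(1)] by blast
  obtain B E where B: "0 < E" "0 \<le> B" "\<And>n. norm (fps_nth g n) \<le> B * E ^ n * fact n"
    using gevrey1_all[OF assms(2)] by blast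
  define F where "F = max C E"
  define H where "H = (A * B + 1) * (2 * F)"
  have F: "C \<le> F" "E \<le> F" "0 < F" using A(1) by (auto simp: F_def)
  have H: "0 < H" using F A B by (simp add: H_def add_nonneg_pos)
  have "norm (fps_nth (f * g) n) \<le> H ^ n * fact n" if n: "1 \<le> n" for n
  proof -
    have "norm (fps_nth (f * g) n) \<le> (\<Sum>i=0..n. norm (fps_nth f i * fps_nth g (n - i)))"
      unfolding fps_mult_nth by (rule norm_sum)
    also have "\<dots> \<le> (\<Sum>i=0..n. A * B * F ^ n * fact n)"
    proof (rule sum_mono)
      fix i assume "i \<in> {0..n}"
      then have i: "i \<le> n" by simp
      have "fact i * fact (n - i) \<le> (fact n :: nat)"
        using fact_fact_dvd_fact[of i "n - i"] i by (auto intro: dvd_imp_le)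
      then have "real (fact i * fact (n - i)) \<le> real (fact n)" by (simp only: of_nat_le_iff)
      then have fct: "fact i * fact (n - i) \<le> (fact n :: real)" by simp
      have "norm (fps_nth f i * fps_nth g (n - i)) \<le>
          (A * C ^ i * fact i) * (B * E ^ (n - i) * fact (n - i))"
        unfolding norm_mult using A B by (intro mult_mono) auto
      also have "\<dots> = (A * B) * (C ^ i * E ^ (n - i)) * (fact i * fact (n - i))"
        by (simp only: mult_ac)
      also have "\<dots> \<le> (A * B) * (F ^ i * F ^ (n - i)) * fact n"
        using A B F by (intro mult_mono power_mono fct) auto
      also have "F ^ i * F ^ (n - i) = F ^ n" using i by (simp flip: power_add)
      finally show "norm (fps_nth f i * fps_nth g (n - i)) \<le> A * B * F ^ n * fact n" .
    qed
    also have "\<dots> = A * B * (real (n + 1) * F ^ n * fact n)" by simp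
    also have "\<dots> \<le> (A * B + 1) ^ n * (2 ^ n * F ^ n * fact n)"
    proof (rule mult_mono)
      have "A * B \<le> (A * B + 1) ^ 1" by simp
      also have "\<dots> \<le> (A * B + 1) ^ n" using n A B by (intro power_increasing) auto
      finally show "A * B \<le> (A * B + 1) ^ n" .
      have "n + 1 \<le> 2 ^ n" using less_exp[of n] by linarith
      then have "real (n + 1) \<le> real (2 ^ n)" by (simp only: of_nat_le_iff)
      then have "real (n + 1) \<le> 2 ^ n" by simp
      then show "real (n + 1) * F ^ n * fact n \<le> 2 ^ n * F ^ n * fact n"
        using F by (intro mult_right_mono) auto
    qed (use A B F in auto)
    also have "\<dots> = H ^ n * fact n" by (simp add: H_def power_mult_distrib)
    finally show ?thesis .
  qed
  then show ?thesis using H unfolding gevrey1_def by blast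
qed

lemma gevrey1_borel_analytic:
  assumes "gevrey1 f"
  shows "analytic_near_0 (snd (borel_transform f))"
proof -
  obtain C where C: "0 < C" "\<And>n. 1 \<le> n \<Longrightarrow> norm (fps_nth f n) \<le> C ^ n * fact n"
    using assms by (auto simp: gevrey1_def)
  define g where "g = snd (borel_transform f)"
  define r where "r = 1 / (4 * C)"
  have r: "0 < r" using C by (simp add: r_def)
  have bound: "norm (fps_nth g n * of_real r ^ n) \<le> C * (1/2) ^ n" for n
  proof -
    have "norm (fps_nth g n) = norm (fps_nth f (Suc n)) / fact n"
      by (simp add: g_def borel_transform_def norm_divide)
    also have "\<dots> \<le> C ^ Suc n * fact (Suc n) / fact n"
      using C(2)[of "Suc n"] by (intro divide_right_mono) auto
    also have "\<dots> = C ^ Suc n * real (n + 1)" by simp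
    also have "\<dots> \<le> C ^ Suc n * 2 ^ n"
    proof (rule mult_left_mono)
      have "n + 1 \<le> 2 ^ n" using less_exp[of n] by linarith
      then have "real (n + 1) \<le> real (2 ^ n)" by (simp only: of_nat_le_iff)
      then show "real (n + 1) \<le> 2 ^ n" by simp
    qed (use C in auto)
    finally have "norm (fps_nth g n) * r ^ n \<le> C ^ Suc n * 2 ^ n * r ^ n"
      using r by (intro mult_right_mono) auto
    also have "\<dots> = C * (C * 2 * r) ^ n" by (simp add: power_mult_distrib)
    also have "C * 2 * r = 1 / 2" using C(1) by (simp add: r_def)
    finally show ?thesis using r by (simp add: norm_mult norm_power)
  qed
  have "summable (\<lambda>n. fps_nth g n * of_real r ^ n)"
    by (rule summable_comparison_test'[where g = "\<lambda>n. C * (1/2) ^ n"])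
      (use bound in \<open>auto intro!: summable_mult summable_geometric\<close>)
  then have "norm (of_real r :: complex) \<le> fps_conv_radius g"
    unfolding fps_conv_radius_def by (rule conv_radius_geI)
  then have rad: "ereal r \<le> fps_conv_radius g" using r by simp
  have "ball (0 :: complex) r \<subseteq> eball 0 (fps_conv_radius g)"
  proof
    fix x :: complex assume "x \<in> ball 0 r"
    then have "ereal (norm x) < ereal r" by simp
    from less_le_trans[OF this rad] show "x \<in> eball 0 (fps_conv_radius g)"
      by (simp add: in_eball_iff)
  qed
  then have "eval_fps g analytic_on ball 0 r" by (rule analytic_on_eval_fps)
  moreover have "(\<lambda>n. fps_nth g n * x ^ n) sums eval_fps g x" if "x \<in> ball 0 r" for x
    using that rad by (intro sums_eval_fps) (auto intro: less_le_trans[of _ "ereal r"])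
  ultimately show ?thesis
    using r unfolding analytic_near_0_def g_def by blast
qed

lemma framed_knot_mirror:
  assumes "framed_knot D"
  shows "framed_knot (mirror D)"
proof -
  have e: "elem_src (mirror_elem e) = elem_src e" "elem_tgt (mirror_elem e) = elem_tgt e"
    "elem_arcs k i (mirror_elem e) = elem_arcs k i e" for e k i
    by (cases e; simp)+
  have nth: "layer_src (mirror D ! k) = layer_src (D ! k)" "layer_arcs k (mirror D ! k) = layer_arcs k (D ! k)"
    if "k < length D" for k
    using that by (cases "D ! k"; simp add: mirror_def e)+
  have len: "length (mirror D) = length D" by (simp add: mirror_def)
  have "composable o1 (mirror D) v \<longleftrightarrow> composable o1 D v" for o1 v
  proof (induction D arbitrary: o1)
    case (Cons L D)
    obtain l a r where L: "L = (l, a, r)" by (cases L)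
    have "mirror (L # D) = (l, mirror_elem a, r) # mirror D" by (simp add: mirror_def L)
    then show ?case by (simp only: L composable.simps layer_src.simps layer_tgt.simps e Cons.IH)
  qed (simp add: mirror_def)
  moreover have "points (mirror D) = points D"
    by (auto simp: points_def len nth)
  moreover have "arcs (mirror D) = arcs D"
    by (auto simp: arcs_def len nth)
  ultimately show ?thesis using assms len by (auto simp: framed_knot_def)
qed

theorem theorem15:
  fixes K :: diagram and z w :: complex
  assumes "framed_knot K"
  shows "gevrey1 (zjones K z) \<and> analytic_near_0 (snd (borel_transform (zjones K z)))
       \<and> gevrey1 (lorentz K z w) \<and> analytic_near_0 (snd (borel_transform (lorentz K z w)))"
proof -
  have "gevrey1 (zjones K z)" "gevrey1 (zjones (mirror K) w)"
    by (intro gevrey1_zjones framed_knot_mirror assms)+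
  then show ?thesis
    unfolding lorentz_def by (intro conjI gevrey1_borel_analytic gevrey1_mult)
qed

end
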